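(* Let $(G_1,\ldots,G_n)$ be a factorisation of a locally finite quasi-transitive connected graph $G$ (with more than one end). Then $$\operatorname{asdim}(G)\leq\max\big(\{1\}\cup\{\operatorname{asdim}(G_i)\mid 1\leq i\leq n\}\big).$$
   Context: **Conventions.** A group acts quasi-transitively on a graph if it acts by graph automorphisms with only finitely many orbits on vertices; a graph is quasi-transitive if some group acts quasi-transitively on it. A graph is regarded as a metric space with its graph distance. **Factorisation.** Let $G$ be a locally finite quasi-transitive connected graph with more than one end. A tuple $(G_1,\ldots,G_n)$ of locally finite quasi-transitive connected graphs is a factorisation of $G$ if $G$ is obtained by iterated non-trivial tree amalgamations of all $G_i$ of finite adhesion and finite identification respecting the group actions (that is, actions of groups acting quasi-transitively on the graphs being amalgamated). The terms are defined below. **Asymptotic dimension.** A cover $\mathcal V$ of a metric space $X$ is uniformly bounded if $\sup\{\operatorname{diam}(V)\mid V\in\mathcal V\}<\infty$. Its multiplicity is the smallest $n$ such that every $x\in X$ lies in at most $n$ elements of $\mathcal V$. A cover $\mathcal V$ refines a cover $\mathcal U$ if every $V\in\mathcal V$ is contained in some $U\in\mathcal U$. $X$ has asymptotic dimension at most $n$ if for every uniformly bounded open cover $\mathcal V$ of $X$ there is a uniformly bounded open cover $\mathcal U$ of $X$ of multiplicity at most $n+1$ such that $\mathcal V$ refines $\mathcal U$. $\operatorname{asdim}(X)$ is the least such $n$ ($\infty$ if there is none). **Tree amalgamation.** Let $I_1,I_2$ be disjoint sets and $G_1,G_2$ graphs. Let $(S^i_k)_{k\in I_i}$ be families of subsets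 of $V(G_i)$, $i=1,2$, all $S^i_k$ having the same cardinality. For all $k\in I_1,\ \ell\in I_2$ let $\phi_{k\ell}\colon S^1_k\to S^2_\ell$ be a bijection and put $\phi_{\ell k}=\phi_{k\ell}^{-1}$; these are the bonding maps. Let $T$ be a tree with canonical bipartition $\{V_1,V_2\}$ such that all vertices in $V_i$ have degree $|I_i|$. Let $D(T)$ be the set of directed edges of $T$ (each edge $xy$ gives $\overrightarrow{xy}$ and $\overrightarrow{yx}$); for $\vec e=\overrightarrow{xy}$ write $\overleftarrow{e}=\overrightarrow{yx}$. Let $f\colon D(T)\to I_1\cup I_2$ be a labelling such that for every $i\in\{1,2\}$ and every $v\in V_i$ each $k\in I_i$ occurs precisely once among the labels of the directed edges starting at $v$. For $v\in V_i$ let $G_v$ be a copy of $G_i$, with $S^v_k$ the copy of $S^i_k$ in it. $G_1+G_2$ is the graph obtained from the disjoint union of all $G_v$, $v\in V(T)$, by adding, for every $\vec e=\overrightarrow{uv}$ with $f(\vec e)=k$, $f(\overleftarrow e)=\ell$, an edge between each $x\in S^u_k$ and $\phi_{k\ell}(x)\in S^v_\ell$. Contracting all edges of $G_1+G_2$ lying outside the copies $G_v$ gives the tree amalgamation $G_1\ast G_2=G_1\ast_T G_2$ over the connecting tree $T$. Let $\pi\colon V(G_1+G_2)\to V(G_1\ast G_2)$ be the canonical map sending each vertex to the vertex obtained from it after all contractions. The sets $S^i_k$ and their images under $\pi$ in $G_1\ast G_2$ are the adhesion sets. The tree amalgamation has finite adhesion if all its adhesion sets are finite. It is trivial if for some $v\in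 V(T)$ the restriction of $\pi$ to $V(G_v)$ is a bijection (onto $V(G_1\ast G_2)$), and non-trivial otherwise. For $x\in V(G_1\ast G_2)$ let $T_x$ be the maximal subtree of $T$ such that for each node $u$ of $T_x$ the graph $G_u$ contains a vertex $y$ with $\pi(y)=x$. The identification size of $x$ is $|V(T_x)|$. The tree amalgamation has finite identification if the identification sizes of all its vertices are bounded. **Respecting the actions.** Let $\Gamma_i$ be a group acting on $G_i$ for $i=1,2$, and let $\{i,j\}=\{1,2\}$. The tree amalgamation respects $\gamma\in\Gamma_i$ if there is a permutation $\sigma$ of $I_i$ such that for every $k\in I_i$ there exist $\ell\in I_j$ and $\tau$ in the setwise stabiliser of $S_\ell$ in $\Gamma_j$ such that $\phi_{k\ell}=\tau\circ\phi_{\sigma(k)\ell}\circ\gamma|_{S_k}$. It respects $\Gamma_i$ if it respects every $\gamma\in\Gamma_i$. For $k\in I_i$ and $\ell,\ell'\in I_j$, the bonding maps from $k$ to $\ell$ and $\ell'$ are consistent if there exists $\gamma\in\Gamma_j$ such that $\phi_{k\ell}=\gamma\circ\phi_{k\ell'}$. The bonding maps between $J_i\subseteq I_i$ and $J_j\subseteq I_j$ are consistent if they are consistent for all $k\in J_i$ and $\ell,\ell'\in J_j$. The tree amalgamation is of Type 1 respecting the actions of $\Gamma_1$ and $\Gamma_2$ if (i) it respects $\Gamma_1$ and $\Gamma_2$, and (ii) the bonding maps between $I_1$ and $I_2$ are consistent. It is of Type 2 respecting the actions of $\Gamma_1$ and $\Gamma_2$ if (o) $G_1=G_2$, $\Gamma_1=\Gamma_2=:\Gamma$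 and $I_1=I_2=:I$ (formally one works with a bijection $I_1\to I_2$, since $I_1$ and $I_2$ are disjoint), and there exists $J\subseteq I$ such that $f(\vec e)\in J$ if and only if $f(\overleftarrow e)\notin J$; (i) it respects $\Gamma$; and (ii) the bonding maps between $J$ and $I\setminus J$ are consistent. The tree amalgamation respects the actions of $\Gamma_1$ and $\Gamma_2$ if it is of Type 1 or of Type 2 respecting these actions.
   Formalization: In a factorisation, the intermediate graphs of the iterated tree amalgamations are also required to be connected; with empty adhesion sets they could be disconnected, and then the bound can fail. *)

theory Defs
  imports
    "HOL-Analysis.Abstract_Metric_Spaces"
    "HOL-Algebra.Group_Action"
    "HOL-Library.Extended_Nat"
    "HOL-Library.Equipollence"
    "HOL-Library.Multiset"
begin

section \<open>Asymptotic dimension\<close>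

context Metric_space
begin

definition open_cover :: "'a set set \<Rightarrow> bool"
  where "open_cover \<V> \<longleftrightarrow> \<Union>\<V> = M \<and> (\<forall>V\<in>\<V>. openin mtopology V)"

definition uniformly_bounded :: "'a set set \<Rightarrow> bool"
  where "uniformly_bounded \<V> \<longleftrightarrow> (\<exists>B. \<forall>V\<in>\<V>. \<forall>x\<in>V. \<forall>y\<in>V. d x y \<le> B)"

definition in_at_most :: "'a set set \<Rightarrow> nat \<Rightarrow> bool"
  where "in_at_most \<V> n \<longleftrightarrow>
    (\<forall>x\<in>M. finite {V \<in> \<V>. x \<in> V} \<and> card {V \<in> \<V>. x \<in> V} \<le> n)"

definition multiplicity :: "'a set set \<Rightarrow> enat"
  where "multiplicity \<V> =
    (if \<exists>n. in_at_most \<V> n then enat (LEAST n. in_at_most \<V> n) else \<infinity>)"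

definition refines :: "'a set set \<Rightarrow> 'a set set \<Rightarrow> bool"
  where "refines \<V> \<U> \<longleftrightarrow> (\<forall>V\<in>\<V>. \<exists>U\<in>\<U>. V \<subseteq> U)"

definition asdim_at_most :: "nat \<Rightarrow> bool"
  where "asdim_at_most n \<longleftrightarrow>
    (\<forall>\<V>. open_cover \<V> \<and> uniformly_bounded \<V> \<longrightarrow>
      (\<exists>\<U>. open_cover \<U> \<and> uniformly_bounded \<U> \<and>
        multiplicity \<U> \<le> enat (n + 1) \<and> refines \<V> \<U>))"

definition asdim :: enat
  where "asdim = (if \<exists>n. asdim_at_most n then enat (LEAST n. asdim_at_most n) else \<infinity>)"

end


section \<open>Graphs\<close>

text \<open>An undirected simple graph is given by its vertex set and its symmetric irreflexive
  adjacency relation; an edge \<open>xy\<close> contributes both pairs \<open>(x, y)\<close> and \<open>(y, x)\<close>, so that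
  \<open>adj\<close> is also the set of directed edges.\<close>

record 'v ugraph =
  verts :: "'v set"
  adj :: "('v \<times> 'v) set"

definition simple_graph :: "'v ugraph \<Rightarrow> bool"
  where "simple_graph G \<longleftrightarrow> adj G \<subseteq> verts G \<times> verts G \<and> sym (adj G) \<and> irrefl (adj G)"

definition nbrs :: "'v ugraph \<Rightarrow> 'v \<Rightarrow> 'v set"
  where "nbrs G x = {y. (x, y) \<in> adj G}"

definition locally_finite :: "'v ugraph \<Rightarrow> bool"
  where "locally_finite G \<longleftrightarrow> (\<forall>x\<in>verts G. finite (nbrs G x))"

definition connected_graph :: "'v ugraph \<Rightarrow> bool"
  where "connected_graph G \<longleftrightarrow>
    verts G \<noteq> {} \<and> (\<forall>x\<in>verts G. \<forall>y\<in>verts G. (x, y) \<in> (adj G)\<^sup>*)"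

definition graph_iso :: "'v ugraph \<Rightarrow> 'w ugraph \<Rightarrow> bool"
  where "graph_iso G H \<longleftrightarrow>
    (\<exists>h. bij_betw h (verts G) (verts H) \<and>
      (\<forall>x\<in>verts G. \<forall>y\<in>verts G. (x, y) \<in> adj G \<longleftrightarrow> (h x, h y) \<in> adj H))"

text \<open>Only meaningful for connected graphs.\<close>

definition graph_dist :: "'v ugraph \<Rightarrow> 'v \<Rightarrow> 'v \<Rightarrow> nat"
  where "graph_dist G x y = (LEAST n. (x, y) \<in> adj G ^^ n)"

definition graph_asdim :: "'v ugraph \<Rightarrow> enat"
  where "graph_asdim G = Metric_space.asdim (verts G) (\<lambda>x y. real (graph_dist G x y))"

lemma Metric_space_graph_dist:
  assumes "simple_graph G" and "connected_graph G"
  shows "Metric_space (verts G) (\<lambda>x y. real (graph_dist G x y))"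
proof
  have symE: "(x, y) \<in> adj G ^^ n \<Longrightarrow> (y, x) \<in> adj G ^^ n" for x y n
  proof (induction n arbitrary: y)
    case (Suc n)
    then obtain z where "(x, z) \<in> adj G ^^ n" "(z, y) \<in> adj G" by auto
    then have "(z, x) \<in> adj G ^^ n" "(y, z) \<in> adj G"
      using Suc.IH assms(1) by (auto simp: simple_graph_def dest: symD)
    then show ?case by (meson relpow_Suc_I2)
  qed simp
  have ex: "(x, y) \<in> adj G ^^ graph_dist G x y" if "x \<in> verts G" "y \<in> verts G" for x y
  proof -
    have "\<exists>n. (x, y) \<in> adj G ^^ n"
      using assms(2) that by (simp add: connected_graph_def rtrancl_power)
    then show ?thesis unfolding graph_dist_def by (rule LeastI_ex)
  qed
  fix x y z
  show "0 \<le> real (graph_dist G x y)" by simp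
  have "(\<lambda>n. (x, y) \<in> adj G ^^ n) = (\<lambda>n. (y, x) \<in> adj G ^^ n)" using symE by blast
  then show "real (graph_dist G x y) = real (graph_dist G y x)"
    by (simp add: graph_dist_def)
  show "real (graph_dist G x y) = 0 \<longleftrightarrow> x = y" if "x \<in> verts G" "y \<in> verts G"
  proof
    assume "real (graph_dist G x y) = 0"
    then show "x = y" using ex[OF that] by simp
  next
    assume "x = y"
    then have "(x, y) \<in> adj G ^^ 0" by simp
    then show "real (graph_dist G x y) = 0"
      unfolding graph_dist_def by (metis Least_eq_0 of_nat_0)
  qed
  show "real (graph_dist G x z) \<le> real (graph_dist G x y) + real (graph_dist G y z)"
    if "x \<in> verts G" "y \<in> verts G" "z \<in> verts G"
  proof -
    have "(x, z) \<in> adj G ^^ (graph_dist G x y + graph_dist G y z)"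
      using ex[OF that(1,2)] ex[OF that(2,3)] by (auto simp: relpow_add)
    then have "graph_dist G x z \<le> graph_dist G x y + graph_dist G y z"
      unfolding graph_dist_def[of G x z] by (rule Least_le)
    then show ?thesis by linarith
  qed
qed


subsection \<open>Ends\<close>

text \<open>Ends are classes of rays, two rays being equivalent if no finite set of vertices
  separates their tails.\<close>

definition rays :: "'v ugraph \<Rightarrow> (nat \<Rightarrow> 'v) set"
  where "rays G = {r. inj r \<and> (\<forall>n. (r n, r (Suc n)) \<in> adj G)}"

definition ray_equiv :: "'v ugraph \<Rightarrow> ((nat \<Rightarrow> 'v) \<times> (nat \<Rightarrow> 'v)) set"
  where "ray_equiv G = {(r, s). r \<in> rays G \<and> s \<in> rays G \<and>
    (\<forall>F. finite F \<longrightarrow>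
      (\<exists>N. \<forall>m\<ge>N. \<forall>n\<ge>N. r m \<notin> F \<and> s n \<notin> F \<and> (r m, s n) \<in> (adj G \<inter> (- F) \<times> (- F))\<^sup>*))}"

definition ends :: "'v ugraph \<Rightarrow> (nat \<Rightarrow> 'v) set set"
  where "ends G = rays G // ray_equiv G"

definition more_than_one_end :: "'v ugraph \<Rightarrow> bool"
  where "more_than_one_end G \<longleftrightarrow> (\<exists>\<epsilon>\<in>ends G. \<exists>\<eta>\<in>ends G. \<epsilon> \<noteq> \<eta>)"


subsection \<open>Trees\<close>

definition cycle :: "'v ugraph \<Rightarrow> 'v list \<Rightarrow> bool"
  where "cycle G p \<longleftrightarrow> 3 \<le> length p \<and> distinct p \<and>
    (\<forall>i. Suc i < length p \<longrightarrow> (p ! i, p ! Suc i) \<in> adj G) \<and> (last p, hd p) \<in> adj G"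

definition tree :: "'v ugraph \<Rightarrow> bool"
  where "tree T \<longleftrightarrow> simple_graph T \<and> connected_graph T \<and> (\<nexists>p. cycle T p)"

definition induced :: "'v ugraph \<Rightarrow> 'v set \<Rightarrow> 'v ugraph"
  where "induced G U = \<lparr>verts = verts G \<inter> U, adj = adj G \<inter> U \<times> U\<rparr>"


subsection \<open>Group actions on graphs\<close>

definition acts_on_graph :: "('g, 'b) monoid_scheme \<Rightarrow> ('g \<Rightarrow> 'v \<Rightarrow> 'v) \<Rightarrow> 'v ugraph \<Rightarrow> bool"
  where "acts_on_graph \<Gamma> \<psi> G \<longleftrightarrow> group_action \<Gamma> (verts G) \<psi> \<and>
    (\<forall>g\<in>carrier \<Gamma>. \<forall>x\<in>verts G. \<forall>y\<in>verts G.
      (x, y) \<in> adj G \<longleftrightarrow> (\<psi> g x, \<psi> g y) \<in> adj G)"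

definition acts_quasi_transitively ::
    "('g, 'b) monoid_scheme \<Rightarrow> ('g \<Rightarrow> 'v \<Rightarrow> 'v) \<Rightarrow> 'v ugraph \<Rightarrow> bool"
  where "acts_quasi_transitively \<Gamma> \<psi> G \<longleftrightarrow>
    acts_on_graph \<Gamma> \<psi> G \<and> finite (orbits \<Gamma> (verts G) \<psi>)"

text \<open>It is no restriction to take the group elements from \<open>'v \<Rightarrow> 'v\<close>: replacing a group by its
  image among the permutations of the vertices changes neither this notion nor any of the
  conditions on actions below.\<close>

definition quasi_transitive :: "'v ugraph \<Rightarrow> bool"
  where "quasi_transitive G \<longleftrightarrow>
    (\<exists>(\<Gamma> :: ('v \<Rightarrow> 'v) monoid) \<psi>. acts_quasi_transitively \<Gamma> \<psi> G)"

definition lfqtc_graph :: "'v ugraph \<Rightarrow> bool"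
  where "lfqtc_graph G \<longleftrightarrow>
    simple_graph G \<and> locally_finite G \<and> quasi_transitive G \<and> connected_graph G"


section \<open>Tree amalgamations\<close>

datatype side = First | Second

fun other :: "side \<Rightarrow> side" where
  "other First = Second"
| "other Second = First"

text \<open>The data of a tree amalgamation: the two graphs \<open>G\<^sub>i\<close>, the index sets \<open>I\<^sub>i\<close>, the
  adhesion sets \<open>S\<^sub>k\<close>, the bonding maps \<open>\<phi>\<^sub>k\<^sub>l\<close>, the connecting tree, the class \<open>V\<^sub>i\<close> of its
  bipartition that a node belongs to, and the labelling of its directed edges. As the index
  sets are disjoint, a single family \<open>S\<close> covers both sides and a single family \<open>\<phi>\<close> covers
  both directions.\<close>

record ('v, 'i, 't) amalg =
  base :: "side \<Rightarrow> 'v ugraph"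
  idx :: "side \<Rightarrow> 'i set"
  adh :: "'i \<Rightarrow> 'v set"
  bond :: "'i \<Rightarrow> 'i \<Rightarrow> 'v \<Rightarrow> 'v"
  ctree :: "'t ugraph"
  cls :: "'t \<Rightarrow> side"
  lab :: "'t \<times> 't \<Rightarrow> 'i"

text \<open>The last conjunct says that every \<open>k \<in> I\<^sub>i\<close> occurs exactly once as a label of an edge
  leaving a node of \<open>V\<^sub>i\<close>, and no other label occurs there; in particular such a node has
  degree \<open>|I\<^sub>i|\<close>.\<close>

definition amalg_data :: "('v, 'i, 't) amalg \<Rightarrow> bool"
  where "amalg_data A \<longleftrightarrow>
    (\<forall>i. simple_graph (base A i)) \<and>
    idx A First \<inter> idx A Second = {} \<and>
    (\<forall>i. \<forall>k\<in>idx A i. adh A k \<subseteq> verts (base A i)) \<and>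
    (\<forall>k\<in>idx A First \<union> idx A Second. \<forall>l\<in>idx A First \<union> idx A Second. adh A k \<approx> adh A l) \<and>
    (\<forall>k\<in>idx A First. \<forall>l\<in>idx A Second.
      bij_betw (bond A k l) (adh A k) (adh A l) \<and>
      (\<forall>x\<in>adh A k. bond A l k (bond A k l x) = x)) \<and>
    tree (ctree A) \<and>
    (\<forall>(u, v)\<in>adj (ctree A). cls A u \<noteq> cls A v) \<and>
    (\<forall>v\<in>verts (ctree A). bij_betw (\<lambda>w. lab A (v, w)) (nbrs (ctree A) v) (idx A (cls A v)))"

text \<open>The pair \<open>(v, x)\<close> is the copy of the vertex \<open>x\<close> in \<open>G\<^sub>v\<close>.\<close>

definition copy :: "('v, 'i, 't) amalg \<Rightarrow> 't \<Rightarrow> 'v ugraph"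
  where "copy A v = base A (cls A v)"

definition conn_edges :: "('v, 'i, 't) amalg \<Rightarrow> (('t \<times> 'v) \<times> ('t \<times> 'v)) set"
  where "conn_edges A = {((u, x), (v, bond A (lab A (u, v)) (lab A (v, u)) x)) | u v x.
    (u, v) \<in> adj (ctree A) \<and> x \<in> adh A (lab A (u, v))}"

definition graph_sum :: "('v, 'i, 't) amalg \<Rightarrow> ('t \<times> 'v) ugraph"
  where "graph_sum A =
    \<lparr>verts = (SIGMA v:verts (ctree A). verts (copy A v)),
     adj = {((v, x), (v, y)) | v x y. v \<in> verts (ctree A) \<and> (x, y) \<in> adj (copy A v)}
       \<union> conn_edges A\<rparr>"

text \<open>Contracting the connecting edges identifies the vertices of \<open>G\<^sub>1 + G\<^sub>2\<close> that are joined
  by a path of such edges. The vertices of the contraction are the resulting classes.\<close>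

definition proj :: "('v, 'i, 't) amalg \<Rightarrow> 't \<times> 'v \<Rightarrow> ('t \<times> 'v) set"
  where "proj A p = (conn_edges A)\<^sup>* `` {p}"

definition amalgamation :: "('v, 'i, 't) amalg \<Rightarrow> ('t \<times> 'v) set ugraph"
  where "amalgamation A =
    \<lparr>verts = proj A ` verts (graph_sum A),
     adj = {(proj A p, proj A q) | p q. (p, q) \<in> adj (graph_sum A) \<and> proj A p \<noteq> proj A q}\<rparr>"

definition finite_adhesion :: "('v, 'i, 't) amalg \<Rightarrow> bool"
  where "finite_adhesion A \<longleftrightarrow> (\<forall>i. \<forall>k\<in>idx A i. finite (adh A k))"

definition trivial_amalg :: "('v, 'i, 't) amalg \<Rightarrow> bool"
  where "trivial_amalg A \<longleftrightarrow>
    (\<exists>v\<in>verts (ctree A).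
      bij_betw (proj A) ({v} \<times> verts (copy A v)) (verts (amalgamation A)))"

text \<open>Subtrees of the connecting tree are identified with their node sets.\<close>

definition ident_subtree :: "('v, 'i, 't) amalg \<Rightarrow> ('t \<times> 'v) set \<Rightarrow> 't set \<Rightarrow> bool"
  where "ident_subtree A x U \<longleftrightarrow>
    U \<subseteq> verts (ctree A) \<and> tree (induced (ctree A) U) \<and>
    (\<forall>u\<in>U. \<exists>y\<in>verts (copy A u). proj A (u, y) = x)"

definition max_ident_subtree :: "('v, 'i, 't) amalg \<Rightarrow> ('t \<times> 'v) set \<Rightarrow> 't set \<Rightarrow> bool"
  where "max_ident_subtree A x U \<longleftrightarrow>
    ident_subtree A x U \<and> (\<forall>W. ident_subtree A x W \<and> U \<subseteq> W \<longrightarrow> W = U)"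

definition finite_identification :: "('v, 'i, 't) amalg \<Rightarrow> bool"
  where "finite_identification A \<longleftrightarrow>
    (\<exists>N. \<forall>x\<in>verts (amalgamation A). \<forall>U. max_ident_subtree A x U \<longrightarrow> finite U \<and> card U \<le> N)"


subsection \<open>Respecting group actions\<close>

text \<open>The group \<open>\<Gamma> i\<close> acts on \<open>G\<^sub>i\<close> via \<open>\<psi> i\<close>. The inclusion makes the composition
  \<open>\<tau> \<circ> \<phi>\<^bsub>\<sigma>(k)l\<^esub> \<circ> \<gamma>|S\<^sub>k\<close> well defined, as \<open>\<phi>\<^bsub>\<sigma>(k)l\<^esub>\<close> is a map on \<open>S\<^bsub>\<sigma>(k)\<^esub>\<close>.\<close>

definition respects_element ::
    "('v, 'i, 't) amalg \<Rightarrow> (side \<Rightarrow> 'g monoid) \<Rightarrow> (side \<Rightarrow> 'g \<Rightarrow> 'v \<Rightarrow> 'v) \<Rightarrow> side \<Rightarrow> 'g \<Rightarrow> bool"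
  where "respects_element A \<Gamma> \<psi> i \<gamma> \<longleftrightarrow>
    (\<exists>\<sigma>. bij_betw \<sigma> (idx A i) (idx A i) \<and>
      (\<forall>k\<in>idx A i. \<exists>l\<in>idx A (other i). \<exists>\<tau>\<in>carrier (\<Gamma> (other i)).
        \<psi> (other i) \<tau> ` adh A l = adh A l \<and>
        \<psi> i \<gamma> ` adh A k \<subseteq> adh A (\<sigma> k) \<and>
        (\<forall>x\<in>adh A k. bond A k l x = \<psi> (other i) \<tau> (bond A (\<sigma> k) l (\<psi> i \<gamma> x)))))"

definition respects_group ::
    "('v, 'i, 't) amalg \<Rightarrow> (side \<Rightarrow> 'g monoid) \<Rightarrow> (side \<Rightarrow> 'g \<Rightarrow> 'v \<Rightarrow> 'v) \<Rightarrow> side \<Rightarrow> bool"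
  where "respects_group A \<Gamma> \<psi> i \<longleftrightarrow> (\<forall>\<gamma>\<in>carrier (\<Gamma> i). respects_element A \<Gamma> \<psi> i \<gamma>)"

definition consistent ::
    "('v, 'i, 't) amalg \<Rightarrow> (side \<Rightarrow> 'g monoid) \<Rightarrow> (side \<Rightarrow> 'g \<Rightarrow> 'v \<Rightarrow> 'v) \<Rightarrow> side \<Rightarrow>
      'i \<Rightarrow> 'i \<Rightarrow> 'i \<Rightarrow> bool"
  where "consistent A \<Gamma> \<psi> j k l l' \<longleftrightarrow>
    (\<exists>\<gamma>\<in>carrier (\<Gamma> j). \<forall>x\<in>adh A k. bond A k l x = \<psi> j \<gamma> (bond A k l' x))"

text \<open>Here \<open>J\<^sub>1 \<subseteq> I\<^sub>1\<close> and \<open>J\<^sub>2 \<subseteq> I\<^sub>2\<close>; consistency is a condition on the bonding maps in both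
  directions.\<close>

definition consistent_between ::
    "('v, 'i, 't) amalg \<Rightarrow> (side \<Rightarrow> 'g monoid) \<Rightarrow> (side \<Rightarrow> 'g \<Rightarrow> 'v \<Rightarrow> 'v) \<Rightarrow>
      'i set \<Rightarrow> 'i set \<Rightarrow> bool"
  where "consistent_between A \<Gamma> \<psi> J\<^sub>1 J\<^sub>2 \<longleftrightarrow>
    (\<forall>k\<in>J\<^sub>1. \<forall>l\<in>J\<^sub>2. \<forall>l'\<in>J\<^sub>2. consistent A \<Gamma> \<psi> Second k l l') \<and>
    (\<forall>k\<in>J\<^sub>2. \<forall>l\<in>J\<^sub>1. \<forall>l'\<in>J\<^sub>1. consistent A \<Gamma> \<psi> First k l l')"

definition type1_respecting ::
    "('v, 'i, 't) amalg \<Rightarrow> (side \<Rightarrow> 'g monoid) \<Rightarrow> (side \<Rightarrow> 'g \<Rightarrow> 'v \<Rightarrow> 'v) \<Rightarrow> bool"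
  where "type1_respecting A \<Gamma> \<psi> \<longleftrightarrow>
    respects_group A \<Gamma> \<psi> First \<and> respects_group A \<Gamma> \<psi> Second \<and>
    consistent_between A \<Gamma> \<psi> (idx A First) (idx A Second)"

text \<open>The index sets are identified along \<open>\<beta>\<close>, so \<open>J \<subseteq> I\<close> becomes \<open>J \<union> \<beta> ` J\<close>, and the bonding
  maps between \<open>J\<close> and \<open>I - J\<close> include those with \<open>J\<close> taken on either side.\<close>

definition type2_respecting ::
    "('v, 'i, 't) amalg \<Rightarrow> (side \<Rightarrow> 'g monoid) \<Rightarrow> (side \<Rightarrow> 'g \<Rightarrow> 'v \<Rightarrow> 'v) \<Rightarrow> bool"
  where "type2_respecting A \<Gamma> \<psi> \<longleftrightarrow>
    base A First = base A Second \<and> \<Gamma> First = \<Gamma> Second \<and> \<psi> First = \<psi> Second \<and>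
    (\<exists>\<beta> J. bij_betw \<beta> (idx A First) (idx A Second) \<and>
      (\<forall>k\<in>idx A First. adh A (\<beta> k) = adh A k) \<and>
      J \<subseteq> idx A First \<and>
      (\<forall>(u, v)\<in>adj (ctree A). lab A (u, v) \<in> J \<union> \<beta> ` J \<longleftrightarrow> lab A (v, u) \<notin> J \<union> \<beta> ` J) \<and>
      respects_group A \<Gamma> \<psi> First \<and> respects_group A \<Gamma> \<psi> Second \<and>
      consistent_between A \<Gamma> \<psi> J (idx A Second - \<beta> ` J) \<and>
      consistent_between A \<Gamma> \<psi> (idx A First - J) (\<beta> ` J))"

definition respects_actions ::
    "('v, 'i, 't) amalg \<Rightarrow> (side \<Rightarrow> 'g monoid) \<Rightarrow> (side \<Rightarrow> 'g \<Rightarrow> 'v \<Rightarrow> 'v) \<Rightarrow> bool"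
  where "respects_actions A \<Gamma> \<psi> \<longleftrightarrow> type1_respecting A \<Gamma> \<psi> \<or> type2_respecting A \<Gamma> \<psi>"

definition respects_quasi_transitive_actions :: "('v, 'i, 't) amalg \<Rightarrow> bool"
  where "respects_quasi_transitive_actions A \<longleftrightarrow>
    (\<exists>(\<Gamma> :: side \<Rightarrow> ('v \<Rightarrow> 'v) monoid) \<psi>.
      (\<forall>i. acts_quasi_transitively (\<Gamma> i) (\<psi> i) (base A i)) \<and> respects_actions A \<Gamma> \<psi>)"


section \<open>Factorisations\<close>

text \<open>\<open>iterated_amalgamation TYPE('i) TYPE('t) H \<K>\<close>: the graph \<open>H\<close> arises, up to isomorphism, by
  iterated tree amalgamations, in any order and bracketing, that use every member of the
  multiset \<open>\<K>\<close> once. The type arguments only name the types that the index sets and the nodes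
  of the connecting trees are taken from. The intermediate graphs are again required to be
  locally finite, quasi-transitive and connected. Connectedness does not come for free, since
  empty adhesion sets yield disconnected amalgamations.\<close>

inductive iterated_amalgamation ::
    "'i itself \<Rightarrow> 't itself \<Rightarrow> 'v ugraph \<Rightarrow> 'v ugraph multiset \<Rightarrow> bool"
  for ti :: "'i itself" and tt :: "'t itself"
  where
    single: "\<lbrakk>lfqtc_graph H; graph_iso H K\<rbrakk> \<Longrightarrow> iterated_amalgamation ti tt H {#K#}"
  | amalgamate:
    "\<lbrakk>iterated_amalgamation ti tt (base A First) \<K>;
      iterated_amalgamation ti tt (base A Second) \<L>;
      amalg_data (A :: ('v, 'i, 't) amalg);
      \<not> trivial_amalg A;
      finite_adhesion A;
      finite_identification A;
      respects_quasi_transitive_actions A;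
      lfqtc_graph H;
      graph_iso H (amalgamation A)\<rbrakk>
     \<Longrightarrow> iterated_amalgamation ti tt H (\<K> + \<L>)"

definition factorisation ::
    "'i itself \<Rightarrow> 't itself \<Rightarrow> 'v ugraph \<Rightarrow> 'v ugraph list \<Rightarrow> bool"
  where "factorisation ti tt G Gs \<longleftrightarrow>
    (\<forall>H\<in>set Gs. lfqtc_graph H) \<and> iterated_amalgamation ti tt G (mset Gs)"

end

theory Submission
  imports Defs
begin

text \<open>A graph has asymptotic dimension at most \<open>n\<close> iff for every \<open>R\<close> its vertices can be labelled
  such that the fibres are uniformly bounded and every set of diameter at most \<open>R\<close> receives at most
  \<open>n + 1\<close> labels. A tree amalgamation is a tree of copies of \<open>G\<^sub>1\<close> and \<open>G\<^sub>2\<close> glued along adhesion sets.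
  By finite identification and quasi-transitivity the adhesion sets have uniformly bounded
  diameter, so that the copies are uniformly bi-Lipschitz embedded and can be labelled uniformly.

  Root the tree, and give each vertex the label it has in the highest copy containing it.
  All labels occurring near the adhesion set \<open>S\<^sub>v\<close> towards the parent are merged into one, which in turn
  is merged with the label of \<open>S\<^sub>v\<close> in the parent copy; then crossing an adhesion set creates no new
  label. To keep the fibres bounded this chain of mergers is cut at nodes whose adhesion sets are
  at distance at least a constant \<open>L\<close> from each other, measured along the distance to a base point.
  The cut is shifted slightly below the adhesion set, to a region in which only two labels occur;
  this is where \<open>n \<ge> 1\<close> is needed.\<close>

section \<open>Asymptotic dimension of graphs\<close>

lemma simple_graphD:
  assumes "simple_graph G"
  shows "(x, y) \<in> adj G \<Longrightarrow> x \<in> verts G" and "(x, y) \<in> adj G \<Longrightarrow> y \<in> verts G"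
    and "(x, y) \<in> adj G \<Longrightarrow> (y, x) \<in> adj G" and "(x, x) \<notin> adj G"
  using assms by (auto simp: simple_graph_def dest: symD irreflD)

lemma graph_dist_le: "(x, y) \<in> adj G ^^ n \<Longrightarrow> graph_dist G x y \<le> n"
  unfolding graph_dist_def by (rule Least_le)

lemma graph_dist_self [simp]: "graph_dist G x x = 0"
  using graph_dist_le[where n = 0 and x = x and y = x and G = G] by simp

locale conn_graph =
  fixes G :: "'v ugraph"
  assumes simple: "simple_graph G" and conn: "connected_graph G"
begin

abbreviation V where "V \<equiv> verts G"
abbreviation d where "d \<equiv> graph_dist G"

lemma dist_walk:
  assumes "x \<in> V" "y \<in> V"
  shows "(x, y) \<in> adj G ^^ d x y"
proof -
  have "\<exists>n. (x, y) \<in> adj G ^^ n"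
    using conn assms by (simp add: connected_graph_def rtrancl_power)
  then show ?thesis unfolding graph_dist_def by (rule LeastI_ex)
qed

sublocale metr: Metric_space V "\<lambda>x y. real (d x y)"
  by (rule Metric_space_graph_dist[OF simple conn])

lemma dist_sym: "d x y = d y x"
  using metr.commute[of x y] by simp

lemma dist_triangle: "\<lbrakk>x \<in> V; y \<in> V; z \<in> V\<rbrakk> \<Longrightarrow> d x z \<le> d x y + d y z"
  using metr.triangle[of x y z] by linarith

lemma dist_eq_0: "\<lbrakk>x \<in> V; y \<in> V\<rbrakk> \<Longrightarrow> d x y = 0 \<longleftrightarrow> x = y"
  using metr.zero[of x y] by simp

text \<open>Distances are integers, so the ball of radius 1 about a vertex is a singleton. The
  topology is discrete and openness of covers is automatic.\<close>

lemma openin_subset_verts: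
  assumes "U \<subseteq> V"
  shows "openin metr.mtopology U"
  unfolding metr.openin_mtopology
proof (intro conjI assms allI impI)
  fix x assume x: "x \<in> U"
  have "metr.mball x 1 \<subseteq> U"
    using x by (auto simp: dist_eq_0)
  then show "\<exists>r>0. metr.mball x r \<subseteq> U" by (intro exI[of _ 1]) simp
qed

end

text \<open>Labellings stand in for covers: the fibres of the labelling play the role of the cover, and
  the multiplicity is counted at scale \<open>R\<close>.\<close>

definition scale_labelling ::
    "'v set \<Rightarrow> ('v \<Rightarrow> 'v \<Rightarrow> nat) \<Rightarrow> nat \<Rightarrow> nat \<Rightarrow> nat \<Rightarrow> ('v \<Rightarrow> 'l) \<Rightarrow> bool"
  where "scale_labelling M d n R B f \<longleftrightarrow>
    (\<forall>x\<in>M. \<forall>y\<in>M. f x = f y \<longrightarrow> d x y \<le> B) \<and>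
    (\<forall>C\<subseteq>M. (\<forall>x\<in>C. \<forall>y\<in>C. d x y \<le> R) \<longrightarrow> finite (f ` C) \<and> card (f ` C) \<le> Suc n)"

section \<open>Covers of bounded multiplicity versus labellings\<close>

context Metric_space
begin

lemma in_at_most_mono: "\<lbrakk>in_at_most \<V> m; m \<le> n\<rbrakk> \<Longrightarrow> in_at_most \<V> n"
  unfolding in_at_most_def by fastforce

lemma multiplicity_le_iff: "multiplicity \<V> \<le> enat n \<longleftrightarrow> in_at_most \<V> n"
proof
  assume le: "multiplicity \<V> \<le> enat n"
  then have ex: "\<exists>n. in_at_most \<V> n"
    by (auto simp: multiplicity_def split: if_splits)
  from LeastI_ex[OF ex] have "in_at_most \<V> (LEAST n. in_at_most \<V> n)" .
  moreover have "(LEAST n. in_at_most \<V> n) \<le> n"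
    using ex le by (simp add: multiplicity_def)
  ultimately show "in_at_most \<V> n" by (rule in_at_most_mono)
next
  assume "in_at_most \<V> n"
  then show "multiplicity \<V> \<le> enat n"
    by (auto simp: multiplicity_def intro: Least_le)
qed

text \<open>Only the multiplicity bound in \<open>asdim_at_most n\<close> depends on
  \<open>n\<close>, so the property passes from the least witness to all larger numbers.\<close>

lemma asdim_le_iff: "asdim \<le> enat n \<longleftrightarrow> asdim_at_most n"
proof
  assume le: "asdim \<le> enat n"
  then have ex: "\<exists>n. asdim_at_most n"
    by (auto simp: asdim_def split: if_splits)
  then have "asdim_at_most (LEAST n. asdim_at_most n)" by (rule LeastI_ex)
  moreover have "enat ((LEAST n. asdim_at_most n) + 1) \<le> enat (n + 1)"
    using le ex by (simp add: asdim_def)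
  ultimately show "asdim_at_most n"
    unfolding asdim_at_most_def by (blast intro: order_trans)
next
  assume "asdim_at_most n"
  then show "asdim \<le> enat n"
    by (auto simp: asdim_def intro: Least_le)
qed

end

context conn_graph
begin

text \<open>Apply the definition to the cover by balls of radius \<open>R\<close> and label each
  vertex by a member of the coarser cover that contains its ball. If \<open>x\<close> lies in a set
  of diameter at most \<open>R\<close>, all labels in that set are members containing
  \<open>x\<close>, so the multiplicity bounds their number.\<close>

lemma asdim_le_imp_labelling:
  assumes "graph_asdim G \<le> enat n"
  shows "\<exists>B. \<exists>f :: 'v \<Rightarrow> 'v set. scale_labelling V d n R B f"
proof -
  define bl where "bl x = {y \<in> V. d x y \<le> R}" for x
  have "metr.asdim_at_most n"
    using assms by (simp add: graph_asdim_def metr.asdim_le_iff)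
  moreover have "metr.open_cover (bl ` V)"
    unfolding metr.open_cover_def by (auto simp: bl_def intro!: openin_subset_verts)
  moreover have "metr.uniformly_bounded (bl ` V)"
    unfolding metr.uniformly_bounded_def
  proof (intro exI[of _ "real (2 * R)"] ballI, clarify)
    fix x y c assume c: "c \<in> V" and "x \<in> bl c" "y \<in> bl c"
    then have *: "x \<in> V" "y \<in> V" "d c x \<le> R" "d c y \<le> R" by (auto simp: bl_def)
    then have "d x y \<le> 2 * R"
      using dist_triangle[of x c y] dist_sym[of x c] c by linarith
    then show "real (d x y) \<le> real (2 * R)" by simp
  qed
  ultimately obtain \<U> where \<U>: "metr.open_cover \<U>" "metr.uniformly_bounded \<U>"
      "metr.multiplicity \<U> \<le> enat (n + 1)" "metr.refines (bl ` V) \<U>"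
    unfolding metr.asdim_at_most_def by meson
  obtain b where b: "\<And>U x y. \<lbrakk>U \<in> \<U>; x \<in> U; y \<in> U\<rbrakk> \<Longrightarrow> real (d x y) \<le> b"
    using \<U>(2) unfolding metr.uniformly_bounded_def by auto
  have "\<forall>x\<in>V. \<exists>U\<in>\<U>. bl x \<subseteq> U"
    using \<U>(4) by (auto simp: metr.refines_def)
  then obtain f where f: "\<And>x. x \<in> V \<Longrightarrow> f x \<in> \<U>" "\<And>x. x \<in> V \<Longrightarrow> bl x \<subseteq> f x"
    by metis
  have mem: "x \<in> f y" if "x \<in> V" "y \<in> V" "d y x \<le> R" for x y
    using f(2)[OF that(2)] that by (auto simp: bl_def)
  have mult: "metr.in_at_most \<U> (Suc n)"
    using \<U>(3) by (simp add: metr.multiplicity_le_iff)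
  have "scale_labelling V d n R (nat \<lceil>b\<rceil>) f"
    unfolding scale_labelling_def
  proof (intro conjI ballI impI allI)
    fix x y assume "x \<in> V" "y \<in> V" "f x = f y"
    then have "real (d x y) \<le> b"
      using b[OF f(1)[of x], of x y] mem[of x x] mem[of y y] by simp
    then show "d x y \<le> nat \<lceil>b\<rceil>" by linarith
  next
    fix C assume C: "C \<subseteq> V" "\<forall>x\<in>C. \<forall>y\<in>C. d x y \<le> R"
    have "finite (f ` C) \<and> card (f ` C) \<le> Suc n"
    proof (cases "C = {}")
      case False
      then obtain x where x: "x \<in> C" by blast
      have "f ` C \<subseteq> {U \<in> \<U>. x \<in> U}"
        using C x f(1) mem by blast
      moreover have "finite {U \<in> \<U>. x \<in> U}" "card {U \<in> \<U>. x \<in> U} \<le> Suc n"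
        using mult x C(1) by (auto simp: metr.in_at_most_def)
      ultimately show ?thesis
        by (meson card_mono finite_subset order_trans)
    qed simp
    then show "finite (f ` C)" "card (f ` C) \<le> Suc n" by auto
  qed
  then show ?thesis by blast
qed

text \<open>If \<open>r\<close> bounds the diameters in the given cover, the
  \<open>r\<close>-neighbourhoods of the fibres form the coarser cover. A vertex lies in as many of
  them as its ball of radius \<open>r\<close> has labels, and that ball has diameter at most
  \<open>2 * r\<close>, the scale at which the labelling is taken.\<close>

lemma labelling_imp_asdim_le:
  assumes lab: "\<And>R. \<exists>B. \<exists>f :: 'v \<Rightarrow> 'l. scale_labelling V d n R B f"
  shows "graph_asdim G \<le> enat n"
proof -
  have "metr.asdim_at_most n"
    unfolding metr.asdim_at_most_def
  proof (intro allI impI, elim conjE)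
    fix \<V> assume cov: "metr.open_cover \<V>" and "metr.uniformly_bounded \<V>"
    then obtain b where b: "\<And>U x y. \<lbrakk>U \<in> \<V>; x \<in> U; y \<in> U\<rbrakk> \<Longrightarrow> real (d x y) \<le> b"
      unfolding metr.uniformly_bounded_def by auto
    define r where "r = nat \<lceil>b\<rceil>"
    have r: "d x y \<le> r" if "U \<in> \<V>" "x \<in> U" "y \<in> U" for U x y
      using b[OF that] unfolding r_def by linarith
    obtain B and f :: "'v \<Rightarrow> 'l" where f: "scale_labelling V d n (2 * r) B f"
      using lab by blast
    define U where "U l = {y \<in> V. \<exists>x\<in>V. f x = l \<and> d x y \<le> r}" for l
    have V: "\<Union>\<V> = V" using cov by (simp add: metr.open_cover_def)
    show "\<exists>\<U>. metr.open_cover \<U> \<and> metr.uniformly_bounded \<U> \<and>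
        metr.multiplicity \<U> \<le> enat (n + 1) \<and> metr.refines \<V> \<U>"
    proof (intro exI[of _ "U ` f ` V"] conjI)
      show "metr.open_cover (U ` f ` V)"
        unfolding metr.open_cover_def
      proof (intro conjI ballI)
        have "x \<in> U (f x)" if "x \<in> V" for x
          using that by (auto simp: U_def intro!: bexI[of _ x])
        then show "\<Union> (U ` f ` V) = V" by (auto simp: U_def)
      qed (auto simp: U_def intro!: openin_subset_verts)
      show "metr.uniformly_bounded (U ` f ` V)"
        unfolding metr.uniformly_bounded_def
      proof (intro exI[of _ "real (B + 2 * r)"] ballI, clarify)
        fix x y z assume "x \<in> U (f z)" "y \<in> U (f z)"
        then obtain x' y' where *: "x \<in> V" "y \<in> V" "x' \<in> V" "y' \<in> V" "f x' = f y'"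
            "d x' x \<le> r" "d y' y \<le> r"
          by (auto simp: U_def)
        then have "d x' y' \<le> B" using f by (auto simp: scale_labelling_def)
        then have "d x y \<le> B + 2 * r"
          using dist_triangle[of x x' y] dist_triangle[of x' y' y] * dist_sym[of x x'] by linarith
        then show "real (d x y) \<le> real (B + 2 * r)" by simp
      qed
      show "metr.multiplicity (U ` f ` V) \<le> enat (n + 1)"
        unfolding metr.multiplicity_le_iff metr.in_at_most_def
      proof
        fix x assume x: "x \<in> V"
        define C where "C = {y \<in> V. d y x \<le> r}"
        have "d y z \<le> 2 * r" if "y \<in> C" "z \<in> C" for y z
          using that dist_triangle[of y x z] dist_sym[of x z] x by (simp add: C_def)
        then have C: "finite (f ` C)" "card (f ` C) \<le> Suc n"
          using f by (auto simp: scale_labelling_def C_def)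
        have sub: "{W \<in> U ` f ` V. x \<in> W} \<subseteq> U ` f ` C"
        proof
          fix W assume "W \<in> {W \<in> U ` f ` V. x \<in> W}"
          then obtain l where l: "W = U l" "x \<in> U l" by blast
          then obtain y where "y \<in> C" "f y = l" unfolding U_def C_def by blast
          with l show "W \<in> U ` f ` C" by blast
        qed
        have "card (U ` f ` C) \<le> Suc n"
          using C card_image_le order_trans by blast
        then show "finite {W \<in> U ` f ` V. x \<in> W} \<and> card {W \<in> U ` f ` V. x \<in> W} \<le> n + 1"
          using finite_subset[OF sub] card_mono[OF _ sub] C(1) by simp
      qed
      show "metr.refines \<V> (U ` f ` V)"
        unfolding metr.refines_def
      proof
        fix W assume W: "W \<in> \<V>"
        show "\<exists>Z\<in>U ` f ` V. W \<subseteq> Z"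
        proof (cases "W = {}")
          case True
          have "V \<noteq> {}" using conn by (simp add: connected_graph_def)
          then show ?thesis using True by auto
        next
          case False
          then obtain x where x: "x \<in> W" by blast
          have "W \<subseteq> U (f x)"
          proof
            fix y assume y: "y \<in> W"
            then have "x \<in> V" "y \<in> V" using x W V by blast+
            then show "y \<in> U (f x)" using r[OF W x y] by (auto simp: U_def)
          qed
          moreover have "x \<in> V" using x W V by blast
          ultimately show ?thesis by (intro bexI[of _ "U (f x)"] imageI)
        qed
      qed
    qed
  qed
  then show ?thesis by (simp add: graph_asdim_def metr.asdim_le_iff)
qed

end

section \<open>Invariance under graph isomorphism\<close>

lemma relpow_map:
  assumes "(x, y) \<in> R ^^ n" and "\<And>x y. (x, y) \<in> R \<Longrightarrow> (h x, h y) \<in> S"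
  shows "(h x, h y) \<in> S ^^ n"
  using assms(1)
proof (induction n arbitrary: y)
  case (Suc n)
  then show ?case using assms(2) by (auto intro: relpow_Suc_I)
qed simp

lemma graph_dist_iso:
  assumes G: "simple_graph G" and H: "simple_graph H"
    and bij: "bij_betw h (verts G) (verts H)"
    and adj: "\<And>x y. \<lbrakk>x \<in> verts G; y \<in> verts G\<rbrakk> \<Longrightarrow> (x, y) \<in> adj G \<longleftrightarrow> (h x, h y) \<in> adj H"
    and xy: "x \<in> verts G" "y \<in> verts G"
  shows "graph_dist H (h x) (h y) = graph_dist G x y"
proof -
  define g where "g = inv_into (verts G) h"
  have g: "g (h x) = x" if "x \<in> verts G" for x
    using bij that by (simp add: g_def bij_betw_inv_into_left)
  have h: "h (g x) = x" "g x \<in> verts G" if "x \<in> verts H" for x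
    using bij that unfolding g_def
    by (auto simp: bij_betw_inv_into_right bij_betw_def intro: inv_into_into)
  have "(x, y) \<in> adj G ^^ n \<longleftrightarrow> (h x, h y) \<in> adj H ^^ n" for n
  proof
    assume "(x, y) \<in> adj G ^^ n"
    then show "(h x, h y) \<in> adj H ^^ n"
      by (rule relpow_map) (use adj simple_graphD[OF G] in blast)
  next
    assume "(h x, h y) \<in> adj H ^^ n"
    then have "(g (h x), g (h y)) \<in> adj G ^^ n"
      by (rule relpow_map) (use adj h simple_graphD[OF H] in metis)
    then show "(x, y) \<in> adj G ^^ n" using g xy by simp
  qed
  then show ?thesis by (simp add: graph_dist_def)
qed

lemma graph_iso_imp_connected:
  assumes "graph_iso G H" and G: "simple_graph G" and "connected_graph G"
  shows "connected_graph H"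
proof -
  obtain h where bij: "bij_betw h (verts G) (verts H)"
    and adj: "\<And>x y. \<lbrakk>x \<in> verts G; y \<in> verts G\<rbrakk> \<Longrightarrow> (x, y) \<in> adj G \<longleftrightarrow> (h x, h y) \<in> adj H"
    using assms(1) unfolding graph_iso_def by blast
  have im: "verts H = h ` verts G" using bij by (simp add: bij_betw_def)
  have "(h x, h y) \<in> (adj H)\<^sup>*" if "(x, y) \<in> (adj G)\<^sup>*" for x y
    using that
  proof induction
    case (step y z)
    then have "(h y, h z) \<in> adj H" using adj simple_graphD[OF G] by blast
    with step show ?case by auto
  qed simp
  then show ?thesis using assms(3) unfolding connected_graph_def im by blast
qed

lemma graph_iso_asdim_le:
  fixes G :: "'v ugraph" and H :: "'w ugraph"
  assumes "graph_iso G H" and G: "simple_graph G" "connected_graph G" and H: "simple_graph H"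
    and le: "graph_asdim H \<le> enat n"
  shows "graph_asdim G \<le> enat n"
proof -
  obtain h where bij: "bij_betw h (verts G) (verts H)"
    and adj: "\<And>x y. \<lbrakk>x \<in> verts G; y \<in> verts G\<rbrakk> \<Longrightarrow> (x, y) \<in> adj G \<longleftrightarrow> (h x, h y) \<in> adj H"
    using assms(1) unfolding graph_iso_def by blast
  have dist: "graph_dist H (h x) (h y) = graph_dist G x y"
    if "x \<in> verts G" "y \<in> verts G" for x y
    using graph_dist_iso[OF G(1) H bij adj that] .
  interpret G: conn_graph G using G by unfold_locales
  interpret H: conn_graph H
    using H graph_iso_imp_connected[OF assms(1) G] by unfold_locales
  show ?thesis
  proof (rule G.labelling_imp_asdim_le)
    fix R
    obtain B and f :: "'w \<Rightarrow> 'w set" where f: "scale_labelling (verts H) (graph_dist H) n R B f"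
      using H.asdim_le_imp_labelling[OF le, of R] by blast
    have "scale_labelling (verts G) (graph_dist G) n R B (f \<circ> h)"
      unfolding scale_labelling_def
    proof (intro conjI ballI impI allI)
      fix x y assume xy: "x \<in> verts G" "y \<in> verts G" "(f \<circ> h) x = (f \<circ> h) y"
      then have "h x \<in> verts H" "h y \<in> verts H" using bij bij_betwE by blast+
      then have "graph_dist H (h x) (h y) \<le> B"
        using f xy(3) by (simp add: scale_labelling_def)
      then show "graph_dist G x y \<le> B" using dist xy by simp
    next
      fix C assume C: "C \<subseteq> verts G" "\<forall>x\<in>C. \<forall>y\<in>C. graph_dist G x y \<le> R"
      have "h ` C \<subseteq> verts H" using C(1) bij by (auto simp: bij_betw_def)
      moreover have "\<forall>x\<in>h ` C. \<forall>y\<in>h ` C. graph_dist H x y \<le> R"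
        using C dist by (auto simp: subset_iff)
      ultimately show "finite ((f \<circ> h) ` C)" "card ((f \<circ> h) ` C) \<le> Suc n"
        using f unfolding scale_labelling_def image_comp[symmetric] by auto
    qed
    then show "\<exists>B. \<exists>f :: 'v \<Rightarrow> 'w set. scale_labelling (verts G) (graph_dist G) n R B f" by blast
  qed
qed

section \<open>Rooted tree decompositions\<close>

text \<open>The tree is encoded by its parent function, with the root as a fixed point. The depth
  makes every climb reach the root, which gives induction and recursion along parents.\<close>

locale rooted_tree =
  fixes N :: "'t set" and r :: 't and p :: "'t \<Rightarrow> 't" and dep :: "'t \<Rightarrow> nat"
  assumes root_node: "r \<in> N" "p r = r" "dep r = 0"
    and par: "v \<in> N \<Longrightarrow> p v \<in> N"
    and dep: "\<lbrakk>v \<in> N; v \<noteq> r\<rbrakk> \<Longrightarrow> dep v = Suc (dep (p v))"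
begin

definition anc :: "'t \<Rightarrow> 't \<Rightarrow> bool" (infix "\<preceq>" 50)
  where "u \<preceq> v \<longleftrightarrow> (\<exists>n. (p ^^ n) v = u)"

lemma node_induct [consumes 1, case_names root node]:
  assumes "v \<in> N" and "Q r" and "\<And>v. \<lbrakk>v \<in> N; v \<noteq> r; Q (p v)\<rbrakk> \<Longrightarrow> Q v"
  shows "Q v"
  using assms(1)
proof (induction "dep v" arbitrary: v rule: less_induct)
  case less
  then show ?case
    using assms(2,3) par dep by (cases "v = r") (metis lessI)+
qed

lemma anc_refl [simp]: "v \<preceq> v"
  unfolding anc_def by (rule exI[of _ 0]) simp

lemma anc_trans [trans]: "\<lbrakk>u \<preceq> v; v \<preceq> w\<rbrakk> \<Longrightarrow> u \<preceq> w"
  unfolding anc_def by (metis comp_apply funpow_add)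

lemma anc_par [simp]: "p v \<preceq> v"
  unfolding anc_def by (rule exI[of _ 1]) simp

lemma anc_cases: "u \<preceq> v \<longleftrightarrow> u = v \<or> u \<preceq> p v"
proof
  assume "u \<preceq> v"
  then obtain n where "(p ^^ n) v = u" by (auto simp: anc_def)
  then show "u = v \<or> u \<preceq> p v"
    by (cases n) (auto simp: anc_def funpow_Suc_right simp del: funpow.simps)
qed (auto intro: anc_trans[OF _ anc_par])

lemma anc_root: "v \<in> N \<Longrightarrow> r \<preceq> v"
  by (induction rule: node_induct) (auto intro: anc_trans[OF _ anc_par])

lemma anc_node: "\<lbrakk>u \<preceq> v; v \<in> N\<rbrakk> \<Longrightarrow> u \<in> N"
proof -
  have "v \<in> N \<Longrightarrow> (p ^^ n) v \<in> N" for n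
    by (induction n) (auto simp: par)
  then show "\<lbrakk>u \<preceq> v; v \<in> N\<rbrakk> \<Longrightarrow> u \<in> N" by (auto simp: anc_def)
qed

lemma anc_of_root: "u \<preceq> r \<Longrightarrow> u = r"
proof -
  have "(p ^^ n) r = r" for n
    by (induction n) (auto simp: root_node)
  then show "u \<preceq> r \<Longrightarrow> u = r" by (auto simp: anc_def)
qed

lemma anc_dep_less: "\<lbrakk>v \<in> N; u \<preceq> v; u \<noteq> v\<rbrakk> \<Longrightarrow> dep u < dep v"
proof (induction arbitrary: u rule: node_induct)
  case root
  then show ?case using anc_of_root by blast
next
  case (node v)
  then have "u \<preceq> p v" using anc_cases by blast
  then show ?case using node(3)[of u] dep[OF node(1,2)] by (cases "u = p v") auto
qed

lemma anc_dep: "\<lbrakk>v \<in> N; u \<preceq> v\<rbrakk> \<Longrightarrow> dep u \<le> dep v"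
  using anc_dep_less by (cases "u = v") fastforce+

lemma anc_antisym: "\<lbrakk>v \<in> N; u \<preceq> v; v \<preceq> u\<rbrakk> \<Longrightarrow> u = v"
  using anc_dep_less anc_node by (metis less_asym)

lemma anc_linear: "\<lbrakk>a \<preceq> w; b \<preceq> w\<rbrakk> \<Longrightarrow> a \<preceq> b \<or> b \<preceq> a"
proof -
  assume "a \<preceq> w" "b \<preceq> w"
  then obtain m n where mn: "(p ^^ m) w = a" "(p ^^ n) w = b" by (auto simp: anc_def)
  show ?thesis
  proof (cases "m \<le> n")
    case True
    then have "(p ^^ (n - m)) a = b" using mn by (metis comp_apply funpow_add le_add_diff_inverse2)
    then show ?thesis by (auto simp: anc_def)
  next
    case False
    then have "(p ^^ (m - n)) b = a"
      using mn by (metis comp_apply funpow_add le_add_diff_inverse2 nat_le_linear)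
    then show ?thesis by (auto simp: anc_def)
  qed
qed

lemma not_anc_par: "\<lbrakk>v \<in> N; v \<noteq> r\<rbrakk> \<Longrightarrow> \<not> v \<preceq> p v"
  using anc_dep[of "p v" v] dep[of v] par[of v] by auto

text \<open>Recursion on the depth, with the node as an argument of the recursively defined
  function. The functions \<open>ct\<close>, \<open>lam\<close> and \<open>rep\<close> below arise
  in this way.\<close>

lemma par_recursion: "\<exists>g. g r = b \<and> (\<forall>v\<in>N. v \<noteq> r \<longrightarrow> g v = \<Phi> v (g (p v)))"
  using root_node(3) dep
  by (intro exI[of _ "\<lambda>v. rec_nat (\<lambda>v. b) (\<lambda>n k v. \<Phi> v (k (p v))) (dep v) v"]) auto

end

text \<open>\<open>P v\<close> is the part at the node \<open>v\<close>, and \<open>t x\<close> is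
  the highest node whose part contains \<open>x\<close>. The assumption \<open>up\<close> expresses
  that the nodes whose parts contain \<open>x\<close> form a subtree: from each of them one can
  climb to \<open>t x\<close> inside this set.\<close>

locale rooted_decomposition = conn_graph X + rooted_tree N r p dep
  for X :: "'x ugraph" and N :: "'t set" and r p dep +
  fixes P :: "'t \<Rightarrow> 'x set" and t :: "'x \<Rightarrow> 't"
  assumes part: "v \<in> N \<Longrightarrow> P v \<subseteq> verts X" "v \<in> N \<Longrightarrow> P v \<noteq> {}"
    and edge_part: "(x, y) \<in> adj X \<Longrightarrow> \<exists>v\<in>N. x \<in> P v \<and> y \<in> P v"
    and top: "x \<in> verts X \<Longrightarrow> t x \<in> N" "x \<in> verts X \<Longrightarrow> x \<in> P (t x)"
    and up: "\<lbrakk>v \<in> N; x \<in> P v; v \<noteq> t x\<rbrakk> \<Longrightarrow> v \<noteq> r \<and> x \<in> P (p v)"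
begin

lemma part_vert: "\<lbrakk>v \<in> N; x \<in> P v\<rbrakk> \<Longrightarrow> x \<in> V"
  using part(1) by blast

lemma top_anc: "\<lbrakk>v \<in> N; x \<in> P v\<rbrakk> \<Longrightarrow> t x \<preceq> v"
proof (induction rule: node_induct)
  case root
  then show ?case using up[of r x] by (cases "r = t x") (auto simp: root_node)
next
  case (node v)
  then show ?case using up[of v x] anc_cases[of "t x" v] by (cases "v = t x") auto
qed

lemma mem_between: "\<lbrakk>v \<in> N; x \<in> P v; t x \<preceq> u; u \<preceq> v\<rbrakk> \<Longrightarrow> x \<in> P u"
proof (induction rule: node_induct)
  case root
  then show ?case using anc_of_root by auto
next
  case (node v)
  show ?case
  proof (cases "u = v")
    case False
    then have "u \<preceq> p v" using node anc_cases by blast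
    moreover have "v \<noteq> t x" using node False anc_antisym by blast
    ultimately show ?thesis using node up by blast
  qed (use node in simp)
qed

section \<open>Adhesion sets as separators\<close>

definition sep :: "'t \<Rightarrow> 'x set"
  where "sep v = P v \<inter> P (p v)"

text \<open>Both \<open>t x\<close> and \<open>c\<close> are above \<open>v\<close>, hence
  comparable, so \<open>t x\<close> lies strictly above \<open>c\<close>. The path from
  \<open>t x\<close> down to \<open>v\<close> then passes through \<open>p c\<close> and
  \<open>c\<close>.\<close>

lemma mem_sep:
  assumes "v \<in> N" "x \<in> P v" "c \<preceq> v" "\<not> c \<preceq> t x"
  shows "x \<in> sep c"
proof -
  have tv: "t x \<preceq> v" using top_anc assms by blast
  then have "t x \<preceq> c" using anc_linear[OF tv assms(3)] assms(4) by blast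
  moreover have "t x \<noteq> c" using assms(4) by auto
  ultimately have "t x \<preceq> p c" using anc_cases by blast
  moreover have "p c \<preceq> v" using assms(3) anc_trans[OF anc_par] by blast
  ultimately show ?thesis
    using mem_between[OF assms(1,2)] \<open>t x \<preceq> c\<close> assms(3) by (auto simp: sep_def)
qed

lemma sep_not_below:
  assumes "v \<in> N" "v \<noteq> r" "x \<in> sep v"
  shows "\<not> v \<preceq> t x"
proof
  assume "v \<preceq> t x"
  moreover have "t x \<preceq> p v" using assms top_anc par by (auto simp: sep_def)
  ultimately show False using not_anc_par assms anc_trans by blast
qed

text \<open>Take the first vertex of the walk whose top node is not below \<open>c\<close>. It
  shares a part with its predecessor, and that part is below \<open>c\<close>, so the vertex lies in
  \<open>sep c\<close>. The two lengths are recorded so that the result can be applied to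
  geodesics.\<close>

lemma walk_through_sep:
  assumes "(x, z) \<in> adj X ^^ n" "x \<in> V" "c \<preceq> t x" "\<not> c \<preceq> t z"
  shows "\<exists>q\<in>sep c. \<exists>i j. i + j = n \<and> (x, q) \<in> adj X ^^ i \<and> (q, z) \<in> adj X ^^ j"
  using assms
proof (induction n arbitrary: x)
  case (Suc n)
  from Suc.prems(1) obtain y where y: "(x, y) \<in> adj X" "(y, z) \<in> adj X ^^ n"
    by (meson relpow_Suc_D2)
  have yV: "y \<in> V" using y(1) simple_graphD[OF simple] by blast
  show ?case
  proof (cases "c \<preceq> t y")
    case True
    then obtain q i j where "q \<in> sep c" "i + j = n" "(y, q) \<in> adj X ^^ i" "(q, z) \<in> adj X ^^ j"
      using Suc.IH[OF y(2) yV True Suc.prems(4)] by blast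
    then show ?thesis using relpow_Suc_I2[OF y(1)] by (metis add_Suc)
  next
    case False
    obtain v where v: "v \<in> N" "x \<in> P v" "y \<in> P v" using edge_part[OF y(1)] by blast
    have "c \<preceq> v" using Suc.prems(3) top_anc[OF v(1,2)] anc_trans by blast
    then have "y \<in> sep c" using mem_sep v False by blast
    moreover have "(x, y) \<in> adj X ^^ 1" using y(1) by simp
    ultimately show ?thesis using y(2) by (intro bexI[of _ y] exI[of _ 1] exI[of _ n]) auto
  qed
qed auto

lemma dist_through_sep:
  assumes u: "u \<in> N" "x \<in> P u" and c: "c \<preceq> u" and z: "z \<in> V" "\<not> c \<preceq> t z"
  shows "\<exists>q\<in>sep c. d x q + d q z \<le> d x z"
proof (cases "c \<preceq> t x")
  case True
  have x: "x \<in> V" using part_vert u by blast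
  obtain q i j where "q \<in> sep c" "i + j = d x z" "(x, q) \<in> adj X ^^ i" "(q, z) \<in> adj X ^^ j"
    using walk_through_sep[OF dist_walk[OF x z(1)] x True z(2)] by blast
  then show ?thesis using graph_dist_le by (metis add_mono)
next
  case False
  then have "x \<in> sep c" using mem_sep u c by blast
  then show ?thesis by (intro bexI[of _ x]) auto
qed

text \<open>A geodesic from the part at \<open>v\<close> to the part at the root has to cross
  \<open>sep v\<close>; connectedness of the graph enters here.\<close>

lemma sep_nonempty:
  assumes v: "v \<in> N" "v \<noteq> r"
  shows "sep v \<noteq> {}"
proof -
  obtain x y where xy: "x \<in> P v" "y \<in> P r" using part(2) v root_node by blast
  then have "t y = r" using top_anc root_node anc_of_root by blast
  then have "\<not> v \<preceq> t y" using v anc_of_root by auto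
  then show ?thesis using dist_through_sep[of v x v y] xy v part_vert root_node by auto
qed

end

text \<open>The root receives the artificial adhesion set \<open>{b}\<close>, so that every node has a nonempty one.\<close>

locale bounded_decomposition = rooted_decomposition X N r p dep P t
  for X :: "'x ugraph" and N :: "'t set" and r p dep P t +
  fixes D :: nat and b :: 'x
  assumes sep_bound: "\<lbrakk>v \<in> N; v \<noteq> r; x \<in> sep v; y \<in> sep v\<rbrakk> \<Longrightarrow> d x y \<le> D"
    and base: "b \<in> P r"
begin

definition S :: "'t \<Rightarrow> 'x set"
  where "S v = (if v = r then {b} else sep v)"

lemma S_part: "v \<in> N \<Longrightarrow> x \<in> S v \<Longrightarrow> x \<in> P v"
  using base by (auto simp: S_def sep_def split: if_splits)

lemma S_part_par: "v \<in> N \<Longrightarrow> x \<in> S v \<Longrightarrow> x \<in> P (p v)"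
  using base root_node by (auto simp: S_def sep_def split: if_splits)

lemma S_vert: "v \<in> N \<Longrightarrow> x \<in> S v \<Longrightarrow> x \<in> V"
  using S_part part_vert by blast

lemma S_nonempty: "v \<in> N \<Longrightarrow> S v \<noteq> {}"
  using sep_nonempty by (simp add: S_def)

lemma S_bound: "\<lbrakk>v \<in> N; x \<in> S v; y \<in> S v\<rbrakk> \<Longrightarrow> d x y \<le> D"
  using sep_bound by (auto simp: S_def split: if_splits)

text \<open>For \<open>c\<close> other than the root this is separation by \<open>sep c\<close>, as
  a vertex of \<open>S v\<close> has its top node outside the subtree below \<open>c\<close>. If
  \<open>c\<close> is the root, so is \<open>v\<close>, and the only point of the artificial
  adhesion set serves as \<open>q\<close>.\<close>

lemma dist_through_S:
  assumes u: "u \<in> N" "x \<in> P u" and c: "c \<preceq> u" and v: "v \<preceq> c" and z: "z \<in> S v"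
  shows "\<exists>q\<in>S c. d x q + d q z \<le> d x z"
proof (cases "c = r")
  case True
  then have "v = r" using v anc_of_root by blast
  then show ?thesis using z True by (auto simp: S_def)
next
  case False
  have cN: "c \<in> N" and vN: "v \<in> N" using u c v anc_node by blast+
  have "\<not> c \<preceq> t z"
  proof
    assume ctz: "c \<preceq> t z"
    have "t z \<preceq> v" using top_anc S_part z vN by blast
    then have "c = v" using ctz v anc_antisym cN anc_trans by blast
    then show False using sep_not_below[of v z] z vN False ctz by (auto simp: S_def)
  qed
  then show ?thesis
    using dist_through_sep[OF u c S_vert[OF vN z]] False by (simp add: S_def)
qed

text \<open>The distance from the set \<open>S v\<close> to the base point, used to decide where the
  merging of labels is cut.\<close>

definition h :: "'t \<Rightarrow> nat"
  where "h v = (LEAST n. \<exists>x\<in>S v. d x b = n)"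

lemma h_attained: "v \<in> N \<Longrightarrow> \<exists>x\<in>S v. d x b = h v"
proof -
  assume "v \<in> N"
  then have "\<exists>n. \<exists>x\<in>S v. d x b = n" using S_nonempty by blast
  from LeastI_ex[OF this] show ?thesis unfolding h_def .
qed

lemma h_le: "x \<in> S v \<Longrightarrow> h v \<le> d x b"
  unfolding h_def by (rule Least_le) auto

text \<open>A geodesic from \<open>S v\<close> to the base point crosses \<open>S u\<close> for
  every ancestor \<open>u\<close> of \<open>v\<close>.\<close>

lemma h_mono:
  assumes "v \<in> N" "u \<preceq> v"
  shows "h u \<le> h v"
proof -
  obtain x where x: "x \<in> S v" "d x b = h v" using h_attained assms(1) by blast
  have uN: "u \<in> N" using assms anc_node by blast
  obtain q where "q \<in> S u" "d x q + d q b \<le> d x b"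
    using dist_through_S[OF assms(1) S_part[OF assms(1) x(1)] assms(2) anc_root[OF uN], of b]
    by (auto simp: S_def)
  then show ?thesis using h_le[of q u] x by linarith
qed

end

section \<open>Combining the labellings of the parts\<close>

context bounded_decomposition
begin

text \<open>The labels in a ball of radius \<open>R\<close> are traced back to a single part. The
  scale \<open>4 * R + 2 * D\<close> bounds the diameter of the set \<open>A\<close> below, which
  collects the points of that part whose labels are relevant.\<close>

lemma decomposition_labelling:
  fixes f :: "'t \<Rightarrow> 'x \<Rightarrow> 'l" and R n B :: nat
  assumes n: "1 \<le> n"
    and f: "\<And>v. v \<in> N \<Longrightarrow> scale_labelling (P v) d n (4 * R + 2 * D) B (f v)"
  shows "\<exists>K. \<exists>F :: 'x \<Rightarrow> 't \<times> 'l option. scale_labelling V d n R K F"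
proof -
  \<comment> \<open>\<open>L\<close> exceeds by one the amount \<open>4 * R + D\<close> by which
    \<open>h\<close> can grow between nested adhesion sets that both come within
    \<open>2 * R\<close> of one vertex. \<open>R1\<close> bounds the distance from a point of
    \<open>A\<close> to an adhesion set above it that comes within \<open>2 * R\<close> of the
    ball.\<close>
  define L where "L = 4 * R + D + 1"
  define R1 where "R1 = 6 * R + D"
  \<comment> \<open>Nearness is a property of the label, not of the vertex. Hence \<open>G v\<close>
    factors through \<open>f v\<close> and takes no more values than \<open>f v\<close> on any
    set.\<close>
  define near where "near v l \<longleftrightarrow> (\<exists>y\<in>P v. f v y = l \<and> (\<exists>q\<in>S v. d y q \<le> R1))" for v l
  obtain ct where ct_root: "ct r = r"
    and ct_rec: "\<And>v. v \<in> N \<Longrightarrow> v \<noteq> r \<Longrightarrow>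
      ct v = (if h (ct (p v)) + L \<le> h v then v else ct (p v))"
    using par_recursion[of r "\<lambda>v c. if h c + L \<le> h v then v else c"] by blast
  \<comment> \<open>The label of the chosen point \<open>z v\<close> in the parent part represents
    all of \<open>S v\<close> when labels are passed down.\<close>
  have "\<exists>z. \<forall>v\<in>N. z v \<in> S v" using S_nonempty by (intro bchoice) blast
  then obtain z where z: "\<And>v. v \<in> N \<Longrightarrow> z v \<in> S v" by blast
  \<comment> \<open>The node in the first component keeps labels of different parts apart.
    \<open>None\<close> marks the fresh label created at a cut, \<open>Some\<close> a label
    inherited from the labelling of a part.\<close>
  obtain lam where lam_root: "lam r = (r, None)"
    and lam_rec: "\<And>v. v \<in> N \<Longrightarrow> v \<noteq> r \<Longrightarrow>
      lam v = (if ct v = v then (v, None)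
        else if near (p v) (f (p v) (z v)) then lam (p v) else (p v, Some (f (p v) (z v))))"
    using par_recursion[of "(r, None)" "\<lambda>v l. if ct v = v then (v, None)
        else if near (p v) (f (p v) (z v)) then l else (p v, Some (f (p v) (z v)))"] by blast
  define G where "G v x = (if near v (f v x) then lam v else (v, Some (f v x)))" for v x
  define mu where "mu v = (if v = r then (r, None) else G (p v) (z v))" for v
  define F where "F x = (if \<exists>q\<in>S (ct (t x)). d x q \<le> 2 * R then mu (ct (t x)) else G (t x) x)" for x

  text \<open>The nodes \<open>v\<close> with \<open>ct v = v\<close> are those at which the merging is cut, and \<open>ct v\<close> is the lowest
    such node above \<open>v\<close>; \<open>lam v\<close> is the merged label near \<open>S v\<close>. Below a cut node \<open>v\<close> the label
    \<open>mu v\<close> from above extends to distance \<open>2 * R\<close> from \<open>S v\<close>.\<close>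

  have lam_noncut: "lam v = G (p v) (z v)" if "v \<in> N" "ct v \<noteq> v" for v
    using that lam_rec[of v] ct_root by (cases "v = r") (auto simp: G_def)
  have G_near: "G v x = lam v" if "x \<in> P v" "q \<in> S v" "d x q \<le> R1" for v x q
    using that by (auto simp: G_def near_def)

  have ct_anc: "ct v \<preceq> v" if "v \<in> N" for v
    using that
  proof (induction rule: node_induct)
    case (node v)
    then show ?case using ct_rec[of v] anc_trans[OF _ anc_par] by auto
  qed (simp add: ct_root)
  have ct_node: "ct v \<in> N" if "v \<in> N" for v using anc_node[OF ct_anc that] that by blast
  have ct_below: "ct v = ct u \<or> u \<preceq> ct v \<and> u \<noteq> ct v" if "v \<in> N" "u \<preceq> v" for u v
    using that
  proof (induction rule: node_induct)
    case root
    then have "u = r" using anc_of_root by blast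
    then show ?case by simp
  next
    case (node v)
    show ?case
    proof (cases "u = v")
      case False
      then show ?thesis using node anc_cases[of u v] ct_rec[of v] by auto
    qed simp
  qed
  have ct_idem: "ct (ct v) = ct v" if "v \<in> N" for v
    using that
  proof (induction rule: node_induct)
    case (node v)
    then show ?case using ct_rec[of v] by auto
  qed (simp add: ct_root)
  have h_ct: "h v < h (ct v) + L" if "v \<in> N" for v
    using that
  proof (induction rule: node_induct)
    case (node v)
    then show ?case using ct_rec[of v] by (auto simp: L_def)
  qed (simp add: ct_root L_def)

  have mult: "finite (F ` C) \<and> card (F ` C) \<le> Suc n"
    if C: "C \<subseteq> V" "\<forall>x\<in>C. \<forall>y\<in>C. d x y \<le> R" for C
  proof (cases "C = {}")
    case False
    then obtain x where x: "x \<in> C" by blast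
    then have xV: "x \<in> V" using C by blast
    \<comment> \<open>The ball about \<open>x\<close> replaces \<open>C\<close> because it contains
      the geodesics from \<open>x\<close> to its points, and so the places where these cross
      adhesion sets.\<close>
    define C0 where "C0 = {y \<in> V. d x y \<le> R}"
    have CC0: "C \<subseteq> C0" using C x by (auto simp: C0_def)
    have xC0: "x \<in> C0" using xV by (simp add: C0_def)
    \<comment> \<open>A vertex of the ball whose top node \<open>a\<close> has least depth. The
      whole ball will turn out to lie below \<open>a\<close>.\<close>
    obtain y0 where y0: "y0 \<in> C0" and "\<And>y. y \<in> C0 \<Longrightarrow> dep (t y0) \<le> dep (t y)"
      using ex_has_least_nat[of "\<lambda>y. y \<in> C0" x "\<lambda>y. dep (t y)"] xC0 by blast
    define a where "a = t y0"
    have y0_min: "\<And>y. y \<in> C0 \<Longrightarrow> dep a \<le> dep (t y)"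
      unfolding a_def by fact
    have y0V: "y0 \<in> V" and y0x: "d x y0 \<le> R" using y0 by (auto simp: C0_def)
    have aN: "a \<in> N" using top(1) y0V by (simp add: a_def)
    \<comment> \<open>A vertex of \<open>sep a\<close> has its top node at \<open>p a\<close> or
      above, which contradicts the minimal depth of \<open>a\<close>.\<close>
    have not_sep: "q \<notin> sep a" if "a \<noteq> r" "q \<in> C0" for q
    proof
      assume q: "q \<in> sep a"
      then have "t q \<preceq> p a" using top_anc par aN by (simp add: sep_def)
      then have "dep (t q) \<le> dep (p a)" using anc_dep par aN by blast
      then show False using y0_min[OF that(2)] dep[OF aN that(1)] by simp
    qed
    \<comment> \<open>If only one end of a geodesic from \<open>x\<close> had its top node below
      \<open>a\<close>, the geodesic would meet \<open>sep a\<close> inside the ball. This is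
      applied first to \<open>y0\<close> and \<open>x\<close>, then to \<open>x\<close> and
      \<open>y\<close>.\<close>
    have below: "a \<preceq> t y" if y: "y \<in> C0" for y
    proof -
      have step: "a \<preceq> t w" if uw: "a \<preceq> t u" "u \<in> V" "w \<in> V" "d u w \<le> R" "u = x \<or> w = x" for u w
      proof (rule ccontr)
        assume neg: "\<not> a \<preceq> t w"
        have ar: "a \<noteq> r" using neg anc_root top(1) uw(3) by blast
        obtain q where q: "q \<in> sep a" "d u q + d q w \<le> d u w"
          using dist_through_sep[OF top(1)[OF uw(2)] top(2)[OF uw(2)] uw(1,3) neg] by blast
        have "q \<in> V" using q(1) part_vert aN by (auto simp: sep_def)
        moreover have "d x q \<le> R" using q(2) uw(4,5) dist_sym[of x q] by auto
        ultimately show False using not_sep[OF ar] q(1) by (simp add: C0_def)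
      qed
      have "a \<preceq> t x" using step[of y0 x] y0V xV y0x by (simp add: a_def dist_sym)
      then show ?thesis using step[of x y] xV y by (simp add: C0_def)
    qed
    \<comment> \<open>The top node \<open>a\<close> of \<open>y0\<close> is strictly above
      \<open>c\<close>, so a geodesic from \<open>y\<close> to \<open>y0\<close> crosses
      \<open>S c\<close>; its length is at most \<open>2 * R\<close>.\<close>
    have cross: "\<exists>q\<in>S c. d y q \<le> 2 * R \<and> d q y0 \<le> 2 * R"
      if y: "y \<in> C0" and c: "c \<preceq> t y" "a \<preceq> c" "c \<noteq> a" for y c
    proof -
      have yV: "y \<in> V" using y by (simp add: C0_def)
      have cN: "c \<in> N" using anc_node c(1) top(1) yV by blast
      have "\<not> c \<preceq> t y0" using c anc_antisym cN unfolding a_def by blast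
      moreover have "c \<noteq> r" using c anc_of_root by blast
      ultimately obtain q where q: "q \<in> S c" "d y q + d q y0 \<le> d y y0"
        using dist_through_sep[OF top(1)[OF yV] top(2)[OF yV] c(1) y0V] by (auto simp: S_def)
      have "d y y0 \<le> 2 * R"
        using dist_triangle[OF yV xV y0V] dist_sym[of x y] y y0x by (simp add: C0_def)
      then show ?thesis using q by (intro bexI[of _ q]) auto
    qed
    \<comment> \<open>The radius \<open>2 * R\<close> covers the vertices of the ball and the
      crossing points of geodesics; \<open>D\<close> is added for replacing a crossing point by the
      representative \<open>z u\<close>.\<close>
    define A where "A = {s \<in> P a. d s y0 \<le> 2 * R + D}"
    text \<open>Descending from \<open>a\<close> inside the ball without crossing a cut, the label stays one of \<open>G a ` A\<close>.\<close>
    have descend: "G (p u) (z u) \<in> G a ` A"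
      if y: "y \<in> C0" and u: "u \<in> N" "u \<preceq> t y" "a \<preceq> u" "u \<noteq> a"
        and nocut: "\<And>w. \<lbrakk>a \<preceq> w; w \<noteq> a; w \<preceq> p u\<rbrakk> \<Longrightarrow> ct w \<noteq> w" for y u
      using u nocut
    proof (induction rule: node_induct)
      case root
      then show ?case using anc_of_root[of a] by auto
    next
      case (node u)
      have yV: "y \<in> V" using y by (simp add: C0_def)
      obtain q where q: "q \<in> S u" "d y q \<le> 2 * R" "d q y0 \<le> 2 * R"
        using cross[OF y node.prems(1,2,3)] by blast
      have zu: "z u \<in> S u" "z u \<in> P (p u)" using z S_part_par node.hyps by blast+
      have V: "z u \<in> V" "q \<in> V" using zu(1) q(1) S_vert node.hyps(1) by blast+
      have zq: "d (z u) q \<le> D" using S_bound zu(1) q(1) node.hyps(1) by blast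
      show ?case
      proof (cases "p u = a")
        case True
        have "d (z u) y0 \<le> 2 * R + D" using dist_triangle[OF V y0V] zq q(3) by linarith
        then show ?thesis using True zu(2) by (auto simp: A_def)
      next
        case False
        have pu: "p u \<preceq> t y" "a \<preceq> p u" "p u \<in> N"
          using node.prems(1,2,3) anc_trans[OF anc_par] anc_cases[of a u] par node.hyps(1) by auto
        \<comment> \<open>Since \<open>y\<close> is within \<open>2 * R\<close> of both
          \<open>S u\<close> and \<open>S (p u)\<close>, the point \<open>z u\<close> is within
          \<open>4 * R + D\<close> of \<open>S (p u)\<close>. Its label is therefore the merged one,
          and as \<open>p u\<close> is not a cut, that is the label of \<open>z (p u)\<close> one
          node higher.\<close>
        obtain q' where q': "q' \<in> S (p u)" "d y q' \<le> 2 * R"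
          using cross[OF y pu(1,2) False] by blast
        have q'V: "q' \<in> V" using q'(1) S_vert pu(3) by blast
        have "d (z u) q' \<le> R1"
          using dist_triangle[OF V q'V] dist_triangle[OF V(2) yV q'V] dist_sym[of q y] zq q(2) q'(2)
          unfolding R1_def by linarith
        then have "G (p u) (z u) = lam (p u)" using G_near zu(2) q'(1) by blast
        also have "\<dots> = G (p (p u)) (z (p u))"
          using lam_noncut pu False node.prems(4) by simp
        also have "\<dots> \<in> G a ` A"
        proof (rule node.IH[OF pu(1,2) False])
          fix w assume "a \<preceq> w" "w \<noteq> a" "w \<preceq> p (p u)"
          then show "ct w \<noteq> w" using node.prems(4) anc_trans[OF _ anc_par] by blast
        qed
        finally show ?thesis .
      qed
    qed
    \<comment> \<open>Either no cut lies strictly between \<open>a\<close> and the top node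
      \<open>w\<close> of \<open>y\<close>, endpoint \<open>w\<close> included, and the label
      descends from \<open>a\<close> or from the last cut above it; or the lowest cut
      \<open>u\<close> lies strictly below \<open>a\<close>, and \<open>y\<close> is so close to
      \<open>S u\<close> that it receives the label \<open>mu u\<close> coming from above
      \<open>u\<close>.\<close>
    have labels: "F y \<in> G a ` A \<or>
        F y = mu (ct a) \<and> (\<exists>q\<in>S (ct a). d y q \<le> 2 * R)" if y: "y \<in> C0" for y
    proof -
      define w where "w = t y"
      have yV: "y \<in> V" and yx: "d x y \<le> R" using y by (auto simp: C0_def)
      have wN: "w \<in> N" and yw: "y \<in> P w" using top yV by (auto simp: w_def)
      have aw: "a \<preceq> w" using below[OF y] by (simp add: w_def)
      from ct_below[OF wN aw] show ?thesis
      proof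
        assume cut: "ct w = ct a"
        have nocut: "ct u \<noteq> u" if u: "a \<preceq> u" "u \<noteq> a" "u \<preceq> w" for u
        proof
          assume cu: "ct u = u"
          have "u \<preceq> ct w" using ct_below[OF wN u(3)] cu by auto
          then have "u \<preceq> a" using cut ct_anc[OF aN] anc_trans by metis
          then show False using u(1,2) anc_antisym[OF aN] by blast
        qed
        show ?thesis
        proof (cases "\<exists>q\<in>S (ct a). d y q \<le> 2 * R")
          case True
          then show ?thesis using cut by (auto simp: F_def w_def)
        next
          case False
          then have Fy: "F y = G w y" using cut by (auto simp: F_def w_def)
          show ?thesis
          proof (cases "w = a")
            case True
            have "d y y0 \<le> 2 * R"
              using dist_triangle[OF yV xV y0V] dist_sym[of x y] yx y0x by linarith
            then show ?thesis using Fy True yw by (auto simp: A_def)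
          next
            case False
            obtain q where q: "q \<in> S w" "d y q \<le> 2 * R"
              using cross[OF y _ aw False] by (auto simp: w_def)
            have "G w y = lam w" using G_near[OF yw q(1)] q(2) by (simp add: R1_def)
            also have "\<dots> = G (p w) (z w)" using lam_noncut wN nocut aw False by simp
            also have "\<dots> \<in> G a ` A"
            proof (rule descend[OF y wN _ aw False])
              fix u assume "a \<preceq> u" "u \<noteq> a" "u \<preceq> p w"
              then show "ct u \<noteq> u" using nocut anc_trans[OF _ anc_par] by blast
            qed (simp add: w_def)
            finally show ?thesis using Fy by simp
          qed
        qed
      next
        assume cut: "a \<preceq> ct w \<and> a \<noteq> ct w"
        define u where "u = ct w"
        have u: "u \<in> N" "u \<preceq> w" "a \<preceq> u" "u \<noteq> a" "ct u = u"
          using ct_node ct_anc ct_idem wN cut by (auto simp: u_def)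
        have ur: "u \<noteq> r" using u(3,4) anc_of_root by blast
        obtain q where q: "q \<in> S u" "d y q \<le> 2 * R"
          using cross[OF y _ u(3,4)] u(2) by (auto simp: w_def)
        have qV: "q \<in> V" using S_vert u(1) q(1) by blast
        have "F y = G (p u) (z u)" using q ur by (auto simp: F_def mu_def u_def w_def)
        also have "\<dots> \<in> G a ` A"
        proof (rule descend[OF y u(1) _ u(3,4)])
          \<comment> \<open>A second cut \<open>u'\<close> between \<open>a\<close> and
            \<open>u\<close> is impossible. Cuts on one path have values of \<open>h\<close> at
            least \<open>L\<close> apart, whereas \<open>S u\<close> and \<open>S u'\<close> both
            come within \<open>2 * R\<close> of \<open>y\<close>, so that \<open>h\<close> differs
            by at most \<open>4 * R + D\<close>.\<close>
          fix u' assume u': "a \<preceq> u'" "u' \<noteq> a" "u' \<preceq> p u"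
          show "ct u' \<noteq> u'"
          proof
            assume cu': "ct u' = u'"
            have u'u: "u' \<preceq> u" using u'(3) anc_trans[OF _ anc_par] by blast
            have u'N: "u' \<in> N" using u'u u(1) anc_node by blast
            have puN: "p u \<in> N" using par u(1) .
            have "h (ct (p u)) + L \<le> h u"
            proof (rule ccontr)
              assume "\<not> h (ct (p u)) + L \<le> h u"
              then have "ct (p u) = u" using ct_rec[OF u(1) ur] u(5) by simp
              then show False using ct_anc[OF puN] not_anc_par[OF u(1) ur] by simp
            qed
            moreover have "u' \<preceq> ct (p u)" using ct_below[OF puN u'(3)] cu' by auto
            then have "h u' \<le> h (ct (p u))" using h_mono ct_node puN by blast
            moreover have "h u \<le> h u' + 4 * R + D"
            proof -
              obtain m where m: "m \<in> S u'" "d m b = h u'" using h_attained u'N by blast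
              obtain q' where q': "q' \<in> S u'" "d y q' \<le> 2 * R"
                using cross[OF y _ u'(1,2)] u'u u(2) anc_trans by (auto simp: w_def)
              have V: "m \<in> V" "q' \<in> V" using m(1) q'(1) S_vert u'N by blast+
              have bV: "b \<in> V" using part_vert root_node base by blast
              have "h u \<le> d q b" using h_le q(1) by blast
              also have "\<dots> \<le> d q y + d y q' + d q' m + d m b"
                using dist_triangle[OF qV yV bV] dist_triangle[OF yV V(2) bV]
                  dist_triangle[OF V(2,1) bV] by linarith
              also have "\<dots> \<le> h u' + 4 * R + D"
                using q(2) q'(2) S_bound[OF u'N q'(1) m(1)] m(2) dist_sym[of q y] by linarith
              finally show ?thesis .
            qed
            ultimately show False by (simp add: L_def)
          qed
        qed (use u(2) in \<open>simp add: w_def\<close>)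
        finally show ?thesis ..
      qed
    qed
    \<comment> \<open>If the ball comes within \<open>2 * R\<close> of the last cut above
      \<open>a\<close>, all labels from the part at \<open>a\<close> are merged, and only two labels
      remain; this is where \<open>1 \<le> n\<close> enters. Otherwise the label
      \<open>mu (ct a)\<close> need not be added and the count for \<open>f a\<close>
      suffices.\<close>
    show ?thesis
    proof (cases "\<exists>y\<in>C0. \<exists>q\<in>S (ct a). d y q \<le> 2 * R")
      case True
      then obtain y q where yq: "y \<in> C0" "q \<in> S (ct a)" "d y q \<le> 2 * R" by blast
      have yV: "y \<in> V" and yx: "d x y \<le> R" using yq(1) by (auto simp: C0_def)
      have qV: "q \<in> V" using S_vert ct_node aN yq(2) by blast
      \<comment> \<open>A geodesic from \<open>s\<close> to \<open>q\<close> passes through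
        \<open>S a\<close>, because \<open>ct a\<close> is above \<open>a\<close>. Its length is at
        most \<open>(2 * R + D) + R + R + 2 * R\<close>, which is \<open>R1\<close>.\<close>
      have "G a s = lam a" if s: "s \<in> A" for s
      proof -
        have sP: "s \<in> P a" and sy0: "d s y0 \<le> 2 * R + D" using s by (auto simp: A_def)
        have sV: "s \<in> V" using part_vert aN sP by blast
        obtain q' where q': "q' \<in> S a" "d s q' + d q' q \<le> d s q"
          using dist_through_S[OF aN sP anc_refl ct_anc[OF aN] yq(2)] by blast
        have "d s q \<le> d s y0 + d y0 x + d x y + d y q"
          using dist_triangle[OF sV y0V qV] dist_triangle[OF y0V xV qV] dist_triangle[OF xV yV qV]
          by linarith
        also have "\<dots> \<le> R1"
          using sy0 y0x dist_sym[of x y0] yx yq(3) unfolding R1_def by linarith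
        finally have "d s q' \<le> R1" using q'(2) by linarith
        then show ?thesis using G_near[OF sP q'(1)] by blast
      qed
      then have "F ` C \<subseteq> {lam a, mu (ct a)}" using labels CC0 by fastforce
      moreover have "card {lam a, mu (ct a)} \<le> Suc n" using n by (simp add: card_insert_if)
      ultimately show ?thesis by (meson card_mono finite.simps finite_subset order_trans)
    next
      case False
      have "F ` C \<subseteq> G a ` A" using labels CC0 False by blast
      also have "G a ` A \<subseteq> (\<lambda>l. if near a l then lam a else (a, Some l)) ` f a ` A"
        by (auto simp: G_def image_iff)
      finally have sub: "F ` C \<subseteq> (\<lambda>l. if near a l then lam a else (a, Some l)) ` f a ` A" .
      have "d s s' \<le> 4 * R + 2 * D" if "s \<in> A" "s' \<in> A" for s s'
      proof -
        have "s \<in> V" "s' \<in> V" using that part_vert aN by (auto simp: A_def)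
        then show ?thesis
          using dist_triangle[of s y0 s'] dist_sym[of s' y0] y0V that by (simp add: A_def)
      qed
      then have fin: "finite (f a ` A)" "card (f a ` A) \<le> Suc n"
        using f[OF aN] by (auto simp: scale_labelling_def A_def)
      have "card (F ` C) \<le> card (f a ` A)"
        using card_mono[OF _ sub] card_image_le[OF fin(1)] fin(1) by (meson finite_imageI order_trans)
      then show ?thesis using fin finite_subset[OF sub] by simp
    qed
  qed simp

  text \<open>For bounded fibres: every vertex is close to a bounded set determined by its label.\<close>

  define anchor where "anchor c = (case snd c of None \<Rightarrow> S (fst c)
      | Some l \<Rightarrow> {y \<in> P (fst c). f (fst c) y = l})" for c
  define close where "close c k x \<longleftrightarrow> fst c \<in> N \<and> (\<exists>y\<in>anchor c. d x y \<le> k)" for c k x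
  have anchor_vert: "y \<in> V" if "fst c \<in> N" "y \<in> anchor c" for c y
    using that part_vert S_vert by (auto simp: anchor_def split: option.splits)
  have anchor_bound: "d y y' \<le> B + D" if "fst c \<in> N" "y \<in> anchor c" "y' \<in> anchor c" for c y y'
  proof (cases "snd c")
    case None
    then have "d y y' \<le> D" using that S_bound by (simp add: anchor_def)
    then show ?thesis by simp
  next
    case (Some l)
    then have "d y y' \<le> B" using that f[OF that(1)] by (auto simp: anchor_def scale_labelling_def)
    then show ?thesis by simp
  qed
  have close_trans: "close c (k + d y x) x" if cl: "close c k y" "x \<in> V" "y \<in> V" for c k x y
  proof -
    obtain a where a: "a \<in> anchor c" "d y a \<le> k" "fst c \<in> N" using cl(1) by (auto simp: close_def)
    then have "d x a \<le> k + d y x"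
      using dist_triangle[OF cl(2,3) anchor_vert[of c a]] dist_sym[of x y] by simp
    then show ?thesis using a by (auto simp: close_def)
  qed
  have close_mono: "close c k' x" if "close c k x" "k \<le> k'" for c k k' x
    using that by (auto simp: close_def intro: order_trans)

  \<comment> \<open>Climb from \<open>v\<close> as long as labels are passed on. The climb ends at a
    node \<open>c\<close> without passing beyond the current cut, where the label is either fresh or
    taken from the parent part.\<close>
  have lam_source: "\<exists>c\<in>N. c \<preceq> v \<and> ct c = ct v \<and>
      (lam v = (c, None) \<or> lam v = (p c, Some (f (p c) (z c))))" if "v \<in> N" for v
    using that
  proof (induction rule: node_induct)
    case root
    then show ?case using lam_root root_node by (intro bexI[of _ r]) auto
  next
    case (node v)
    show ?case
    proof (cases "ct v \<noteq> v \<and> near (p v) (f (p v) (z v))")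
      case True
      then have "lam v = lam (p v)" "ct v = ct (p v)"
        using lam_rec[OF node.hyps] ct_rec[OF node.hyps] by (auto split: if_splits)
      then show ?thesis using node.IH anc_trans[OF _ anc_par] by auto
    next
      case False
      then show ?thesis using lam_rec[OF node.hyps] node.hyps by (intro bexI[of _ v]) auto
    qed
  qed
  have lam_close: "close (lam v) (L + 2 * D) x" if v: "v \<in> N" and x: "x \<in> S v" for v x
  proof -
    obtain c where c: "c \<in> N" "c \<preceq> v" "ct c = ct v"
      and lc: "lam v = (c, None) \<or> lam v = (p c, Some (f (p c) (z c)))"
      using lam_source[OF v] by blast
    obtain m where m: "m \<in> S v" "d m b = h v" using h_attained v by blast
    obtain q where q: "q \<in> S c" "d m q + d q b \<le> d m b"
      using dist_through_S[OF v S_part[OF v m(1)] c(2) anc_root[OF c(1)], of b]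
      by (auto simp: S_def)
    \<comment> \<open>Since \<open>c\<close> lies between \<open>ct v\<close> and \<open>v\<close>,
      the value of \<open>h\<close> drops by less than \<open>L\<close> from \<open>v\<close> to
      \<open>c\<close>. As \<open>q\<close> lies on a geodesic from \<open>m\<close> to the base
      point, this drop bounds \<open>d m q\<close>.\<close>
    have "h (ct v) \<le> h c" using h_mono[OF c(1) ct_anc[OF c(1)]] c(3) by simp
    then have mq: "d m q \<le> L" using q m(2) h_le[OF q(1)] h_ct[OF v] by linarith
    have V: "x \<in> V" "m \<in> V" "q \<in> V" using S_vert x m(1) q(1) v c(1) by blast+
    have xq: "d x q \<le> L + D"
      using dist_triangle[OF V] S_bound[OF v x m(1)] mq by linarith
    from lc show ?thesis
    proof
      assume "lam v = (c, None)"
      then show ?thesis using q(1) xq c(1) by (auto simp: close_def anchor_def intro!: bexI[of _ q])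
    next
      assume lam: "lam v = (p c, Some (f (p c) (z c)))"
      have zc: "z c \<in> S c" "z c \<in> P (p c)" using z S_part_par c(1) by blast+
      have "d x (z c) \<le> L + 2 * D"
        using dist_triangle[OF V(1,3), of "z c"] xq S_bound[OF c(1) q(1) zc(1)]
          S_vert[OF c(1) zc(1)] by linarith
      then show ?thesis using zc(2) par[OF c(1)] lam by (auto simp: close_def anchor_def)
    qed
  qed
  \<comment> \<open>From a vertex, move by \<open>B\<close> within its fibre to a vertex witnessing
    nearness, by \<open>R1\<close> to \<open>S v\<close>, and by \<open>L + 2 * D\<close> to the
    source of \<open>lam v\<close>.\<close>
  define K1 where "K1 = L + 2 * D + R1 + B"
  have G_close: "close (G v x) K1 x" if v: "v \<in> N" and x: "x \<in> P v" for v x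
  proof (cases "near v (f v x)")
    case True
    then obtain y q where yq: "y \<in> P v" "f v y = f v x" "q \<in> S v" "d y q \<le> R1"
      by (auto simp: near_def)
    have V: "x \<in> V" "y \<in> V" "q \<in> V" using part_vert S_vert v x yq by blast+
    have "d x y \<le> B" using f[OF v] x yq by (auto simp: scale_labelling_def)
    then have "d q x \<le> R1 + B"
      using dist_triangle[OF V] dist_sym[of q x] yq(4) by linarith
    then have "close (lam v) K1 x"
      using close_mono[OF close_trans[OF lam_close[OF v yq(3)] V(1,3)]] by (simp add: K1_def)
    then show ?thesis using True by (simp add: G_def)
  next
    case False
    then show ?thesis using x v by (auto simp: G_def close_def anchor_def intro!: bexI[of _ x])
  qed
  have mu_close: "close (mu v) (K1 + D) x" if v: "v \<in> N" and x: "x \<in> S v" for v x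
  proof (cases "v = r")
    case True
    then show ?thesis using x root_node(1) by (auto simp: mu_def close_def anchor_def S_def)
  next
    case False
    have zv: "z v \<in> S v" "z v \<in> P (p v)" using z S_part_par v by blast+
    have "close (G (p v) (z v)) (K1 + d (z v) x) x"
      using close_trans[OF G_close[OF par[OF v] zv(2)]] S_vert v x zv(1) by blast
    then show ?thesis
      using close_mono S_bound[OF v zv(1) x] False by (simp add: mu_def)
  qed
  have F_close: "close (F x) (K1 + D + 2 * R) x" if x: "x \<in> V" for x
  proof (cases "\<exists>q\<in>S (ct (t x)). d x q \<le> 2 * R")
    case True
    then obtain q where q: "q \<in> S (ct (t x))" "d x q \<le> 2 * R" by blast
    have ctN: "ct (t x) \<in> N" using ct_node top(1) x by blast
    have "close (mu (ct (t x))) (K1 + D + d q x) x"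
      using close_trans[OF mu_close[OF ctN q(1)] x] S_vert ctN q(1) by blast
    then have "close (mu (ct (t x))) (K1 + D + 2 * R) x"
      by (rule close_mono) (use q(2) dist_sym[of x q] in simp)
    then show ?thesis using True by (simp add: F_def)
  next
    case False
    have "close (G (t x) x) (K1 + D + 2 * R) x"
      using close_mono[OF G_close] top x by simp
    then show ?thesis using False by (simp add: F_def)
  qed
  have "scale_labelling V d n R (2 * (K1 + D + 2 * R) + (B + D)) F"
    unfolding scale_labelling_def
  proof (intro conjI ballI impI allI)
    fix x y assume xy: "x \<in> V" "y \<in> V" "F x = F y"
    obtain u w where uw: "u \<in> anchor (F x)" "w \<in> anchor (F x)" "fst (F x) \<in> N"
      "d x u \<le> K1 + D + 2 * R" "d y w \<le> K1 + D + 2 * R"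
      using F_close[OF xy(1)] F_close[OF xy(2)] xy(3) by (auto simp: close_def)
    have uV: "u \<in> V" and wV: "w \<in> V" using anchor_vert uw by blast+
    have "d x y \<le> d x u + (d u w + d w y)"
      using dist_triangle[OF xy(1) uV xy(2)] dist_triangle[OF uV wV xy(2)] by linarith
    also have "\<dots> \<le> (K1 + D + 2 * R) + ((B + D) + (K1 + D + 2 * R))"
      using anchor_bound uw dist_sym[of w y] by (intro add_mono) auto
    finally show "d x y \<le> 2 * (K1 + D + 2 * R) + (B + D)" by simp
  qed (use mult in auto)
  then show ?thesis by blast
qed

lemma decomposition_asdim_le:
  assumes "1 \<le> n"
    and "\<And>R. \<exists>B. \<forall>v\<in>N. \<exists>f :: 'x \<Rightarrow> 'l. scale_labelling (P v) d n R B f"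
  shows "graph_asdim X \<le> enat n"
proof (rule labelling_imp_asdim_le)
  fix R
  obtain B where "\<forall>v\<in>N. \<exists>f :: 'x \<Rightarrow> 'l. scale_labelling (P v) d n (4 * R + 2 * D) B f"
    using assms(2) by blast
  then obtain f :: "'t \<Rightarrow> 'x \<Rightarrow> 'l"
    where "\<And>v. v \<in> N \<Longrightarrow> scale_labelling (P v) d n (4 * R + 2 * D) B (f v)"
    by metis
  then show "\<exists>B. \<exists>F :: 'x \<Rightarrow> 't \<times> 'l option. scale_labelling V d n R B F"
    using decomposition_labelling[OF assms(1)] by blast
qed

end

section \<open>Rooting a tree\<close>

text \<open>Loop erasure: whenever the walk returns to a vertex already on the path, the path is
  truncated at that vertex.\<close>

lemma walk_imp_simple_path:
  assumes "(x, y) \<in> (R \<inter> Z \<times> Z)\<^sup>*" and "x \<in> Z"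
  shows "\<exists>q. q \<noteq> [] \<and> hd q = x \<and> last q = y \<and> distinct q \<and> set q \<subseteq> Z \<and>
    (\<forall>i. Suc i < length q \<longrightarrow> (q ! i, q ! Suc i) \<in> R)"
  using assms(1)
proof induction
  case base
  then show ?case using assms(2) by (intro exI[of _ "[x]"]) auto
next
  case (step y z)
  then obtain q where q: "q \<noteq> []" "hd q = x" "last q = y" "distinct q" "set q \<subseteq> Z"
      "\<And>i. Suc i < length q \<Longrightarrow> (q ! i, q ! Suc i) \<in> R" by blast
  have yz: "(y, z) \<in> R" "z \<in> Z" using step by auto
  show ?case
  proof (cases "z \<in> set q")
    case True
    then obtain j where j: "j < length q" "q ! j = z" by (auto simp: in_set_conv_nth)
    have "last (take (Suc j) q) = z" using j by (simp add: take_Suc_conv_app_nth)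
    moreover have "set (take (Suc j) q) \<subseteq> Z" using q(5) set_take_subset by fastforce
    ultimately show ?thesis
      using q j by (intro exI[of _ "take (Suc j) q"]) (auto simp: hd_take)
  next
    case False
    have "((q @ [z]) ! i, (q @ [z]) ! Suc i) \<in> R" if "Suc i < length (q @ [z])" for i
    proof (cases "Suc i < length q")
      case True
      then show ?thesis using q(6)[of i] by (simp add: nth_append)
    next
      case False
      then have "i = length q - 1" "Suc i = length q" using that q(1) by auto
      then show ?thesis using q(1,3) yz(1) by (simp add: nth_append last_conv_nth)
    qed
    then show ?thesis using q yz False by (intro exI[of _ "q @ [z]"]) auto
  qed
qed

text \<open>Bipartiteness excludes edges between nodes of equal depth, so that only parents need to be
  shown unique.\<close>

lemma bipartite_tree_rooted:
  fixes T :: "'t ugraph" and cl :: "'t \<Rightarrow> side"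
  assumes T: "tree T" and r: "r \<in> verts T" and cl: "\<And>u v. (u, v) \<in> adj T \<Longrightarrow> cl u \<noteq> cl v"
  shows "\<exists>p dep. rooted_tree (verts T) r p dep \<and>
    (\<forall>v\<in>verts T. v \<noteq> r \<longrightarrow> (v, p v) \<in> adj T) \<and>
    (\<forall>u v. (u, v) \<in> adj T \<longrightarrow> u \<noteq> r \<and> v = p u \<or> v \<noteq> r \<and> u = p v)"
proof -
  interpret conn_graph T using T by unfold_locales (auto simp: tree_def)
  note adjD = simple_graphD[OF simple]
  define dep where "dep = d r"
  have dep_root: "dep r = 0" by (simp add: dep_def)
  have dep_step: "dep v \<le> Suc (dep u)" if "(u, v) \<in> adj T" for u v
    using graph_dist_le[OF relpow_Suc_I[OF dist_walk[OF r adjD(1)[OF that]] that]]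
    by (simp add: dep_def)
  \<comment> \<open>Each edge changes the class, so the class of a node is determined by the parity
    of its distance from the root.\<close>
  have parity: "cl v = cl r \<longleftrightarrow> even k" if "(r, v) \<in> adj T ^^ k" for v k
    using that
  proof (induction k arbitrary: v)
    case (Suc k)
    then obtain u where u: "(r, u) \<in> adj T ^^ k" "(u, v) \<in> adj T" by auto
    have "cl u = cl r \<longleftrightarrow> even k" using Suc.IH u(1) .
    then show ?case using cl[OF u(2)] by (cases "cl u"; cases "cl v"; cases "cl r") auto
  qed simp
  have dep_neq: "dep u \<noteq> dep v" if uv: "(u, v) \<in> adj T" for u v
  proof
    assume "dep u = dep v"
    then have "cl u = cl r \<longleftrightarrow> cl v = cl r"
      using parity[OF dist_walk[OF r adjD(1)[OF uv]]] parity[OF dist_walk[OF r adjD(2)[OF uv]]]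
      by (simp add: dep_def)
    then show False using cl[OF uv] by (cases "cl u"; cases "cl v"; cases "cl r") auto
  qed
  have parent: "\<exists>u. (u, v) \<in> adj T \<and> dep v = Suc (dep u)" if v: "v \<in> verts T" "v \<noteq> r" for v
  proof -
    have "dep v \<noteq> 0" using dist_eq_0[OF r v(1)] v(2) by (auto simp: dep_def)
    then obtain k where k: "dep v = Suc k" using not0_implies_Suc by blast
    then have "(r, v) \<in> adj T ^^ Suc k" using dist_walk[OF r v(1)] by (simp add: dep_def)
    then obtain u where u: "(r, u) \<in> adj T ^^ k" "(u, v) \<in> adj T" by auto
    have "dep u \<le> k" using graph_dist_le[OF u(1)] by (simp add: dep_def)
    then show ?thesis using dep_step[OF u(2)] k u(2) by auto
  qed
  have unique: "u = u'"
    if u: "(u, v) \<in> adj T" "dep v = Suc (dep u)" "(u', v) \<in> adj T" "dep v = Suc (dep u')"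
    for u u' v
  proof (rule ccontr)
    assume neq: "u \<noteq> u'"
    \<comment> \<open>Two parents of \<open>v\<close> are joined through the root by nodes no deeper
      than themselves. A simple path among these avoids \<open>v\<close>, and adding
      \<open>v\<close> closes a cycle.\<close>
    define Z where "Z = {w \<in> verts T. dep w \<le> dep u}"
    have sym: "sym ((adj T \<inter> Z \<times> Z)\<^sup>*)"
      by (rule sym_rtrancl) (use adjD(3) in \<open>auto simp: sym_def\<close>)
    have to_root: "(r, w) \<in> (adj T \<inter> Z \<times> Z)\<^sup>*" if "w \<in> Z" for w
      using that
    proof (induction "dep w" arbitrary: w)
      case 0
      then have "w = r" using dist_eq_0[OF r] by (auto simp: Z_def dep_def)
      then show ?case by simp
    next
      case (Suc k)
      then have "w \<in> verts T" "w \<noteq> r" using dep_root by (auto simp: Z_def)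
      then obtain w' where w': "(w', w) \<in> adj T" "dep w = Suc (dep w')" using parent by blast
      then have "w' \<in> Z" using Suc.prems adjD(1) by (auto simp: Z_def)
      moreover have "k = dep w'" using Suc.hyps(2) w'(2) by simp
      ultimately show ?case using Suc.hyps(1) Suc.prems w'(1) by (auto intro: rtrancl_into_rtrancl)
    qed
    have uZ: "u \<in> Z" "u' \<in> Z" using u adjD(1) by (auto simp: Z_def)
    have "(u, u') \<in> (adj T \<inter> Z \<times> Z)\<^sup>*"
      using to_root[OF uZ(1)] to_root[OF uZ(2)] symD[OF sym] rtrancl_trans by metis
    then obtain q where q: "q \<noteq> []" "hd q = u" "last q = u'" "distinct q" "set q \<subseteq> Z"
        "\<And>i. Suc i < length q \<Longrightarrow> (q ! i, q ! Suc i) \<in> adj T"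
      using walk_imp_simple_path[OF _ uZ(1)] by meson
    have "cycle T (q @ [v])"
      unfolding cycle_def
    proof (intro conjI allI impI)
      have "length q \<noteq> 1" using q(2,3) neq by (auto simp: length_Suc_conv)
      moreover have "length q \<noteq> 0" using q(1) by simp
      ultimately have "2 \<le> length q" by linarith
      then show "3 \<le> length (q @ [v])" by simp
      show "distinct (q @ [v])" using q(4,5) u(2) by (auto simp: Z_def)
      show "(last (q @ [v]), hd (q @ [v])) \<in> adj T" using q(1,2) u(1) adjD(3) by simp
      fix i assume i: "Suc i < length (q @ [v])"
      show "((q @ [v]) ! i, (q @ [v]) ! Suc i) \<in> adj T"
      proof (cases "Suc i < length q")
        case True
        then show ?thesis using q(6)[of i] by (simp add: nth_append)
      next
        case False
        then have "i = length q - 1" "Suc i = length q" using i q(1) by auto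
        then show ?thesis using q(1,3) u(3) by (simp add: nth_append last_conv_nth)
      qed
    qed
    then show False using T by (auto simp: tree_def)
  qed
  define p where "p v = (if v = r then r else SOME u. (u, v) \<in> adj T \<and> dep v = Suc (dep u))" for v
  have p: "(p v, v) \<in> adj T" "dep v = Suc (dep (p v))" if "v \<in> verts T" "v \<noteq> r" for v
    using someI_ex[OF parent[OF that]] that by (auto simp: p_def)
  have p_eq: "v \<noteq> r \<and> u = p v" if uv: "(u, v) \<in> adj T" "dep v = Suc (dep u)" for u v
  proof -
    have "v \<noteq> r" using uv(2) dep_root by auto
    then show ?thesis using unique[OF uv] p adjD(2)[OF uv(1)] by blast
  qed
  have "rooted_tree (verts T) r p dep"
  proof
    show "r \<in> verts T" "dep r = 0" by (fact r, fact dep_root)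
    show pr: "p r = r" by (simp add: p_def)
    show "p v \<in> verts T" if "v \<in> verts T" for v
      using adjD(1)[OF p(1)[OF that]] pr r by (cases "v = r") auto
    show "dep v = Suc (dep (p v))" if "v \<in> verts T" "v \<noteq> r" for v
      using p(2) that .
  qed
  moreover have "\<forall>v\<in>verts T. v \<noteq> r \<longrightarrow> (v, p v) \<in> adj T" using p adjD(3) by blast
  moreover have "u \<noteq> r \<and> v = p u \<or> v \<noteq> r \<and> u = p v" if uv: "(u, v) \<in> adj T" for u v
  proof (cases "dep u < dep v")
    case True
    then have "dep v = Suc (dep u)" using dep_step[OF uv] by simp
    then show ?thesis using p_eq uv by blast
  next
    case False
    then have "dep u = Suc (dep v)"
      using dep_step[OF adjD(3)[OF uv]] dep_neq[OF uv] by simp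
    then show ?thesis using p_eq adjD(3)[OF uv] by blast
  qed
  ultimately show ?thesis by blast
qed

section \<open>Tree amalgamations as rooted tree decompositions\<close>

locale amalgam =
  fixes A :: "('v, 'i, 't) amalg"
  assumes data: "amalg_data A"
    and base_connected: "\<And>i. connected_graph (base A i)"
    and amalgam_connected: "connected_graph (amalgamation A)"
begin

abbreviation N where "N \<equiv> verts (ctree A)"
abbreviation T where "T \<equiv> adj (ctree A)"

text \<open>Adhesion sets and bonding maps are indexed by directed tree edges from here on, which
  removes the labels from later arguments.\<close>

definition adhe :: "'t \<Rightarrow> 't \<Rightarrow> 'v set"
  where "adhe u v = adh A (lab A (u, v))"

definition bonde :: "'t \<Rightarrow> 't \<Rightarrow> 'v \<Rightarrow> 'v"
  where "bonde u v = bond A (lab A (u, v)) (lab A (v, u))"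

definition P :: "'t \<Rightarrow> ('t \<times> 'v) set set"
  where "P v = (\<lambda>x. proj A (v, x)) ` verts (copy A v)"

lemma base_simple: "simple_graph (base A i)"
  and adh_verts: "k \<in> idx A i \<Longrightarrow> adh A k \<subseteq> verts (base A i)"
  and bond_bij: "\<lbrakk>k \<in> idx A First; l \<in> idx A Second\<rbrakk> \<Longrightarrow> bij_betw (bond A k l) (adh A k) (adh A l)"
  and bond_inverse: "\<lbrakk>k \<in> idx A First; l \<in> idx A Second; x \<in> adh A k\<rbrakk> \<Longrightarrow>
    bond A l k (bond A k l x) = x"
  and tree_T: "tree (ctree A)"
  and cls_T: "(u, v) \<in> T \<Longrightarrow> cls A u \<noteq> cls A v"
  and lab_bij: "v \<in> N \<Longrightarrow> bij_betw (\<lambda>w. lab A (v, w)) (nbrs (ctree A) v) (idx A (cls A v))"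
proof -
  note * = data[unfolded amalg_data_def]
  show "simple_graph (base A i)" "tree (ctree A)" using * by blast+
  show "k \<in> idx A i \<Longrightarrow> adh A k \<subseteq> verts (base A i)" using * by blast
  show "\<lbrakk>k \<in> idx A First; l \<in> idx A Second\<rbrakk> \<Longrightarrow> bij_betw (bond A k l) (adh A k) (adh A l)"
    using * by blast
  show "\<lbrakk>k \<in> idx A First; l \<in> idx A Second; x \<in> adh A k\<rbrakk> \<Longrightarrow> bond A l k (bond A k l x) = x"
    using * by blast
  have "\<forall>(u, v)\<in>T. cls A u \<noteq> cls A v" using * by blast
  then show "(u, v) \<in> T \<Longrightarrow> cls A u \<noteq> cls A v" by auto
  show "v \<in> N \<Longrightarrow> bij_betw (\<lambda>w. lab A (v, w)) (nbrs (ctree A) v) (idx A (cls A v))"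
    using * by blast
qed

lemma T_D:
  shows "(u, v) \<in> T \<Longrightarrow> u \<in> N" and "(u, v) \<in> T \<Longrightarrow> v \<in> N"
    and "(u, v) \<in> T \<Longrightarrow> (v, u) \<in> T"
proof -
  have "simple_graph (ctree A)" using tree_T by (simp add: tree_def)
  note * = simple_graphD[OF this]
  show "(u, v) \<in> T \<Longrightarrow> u \<in> N" "(u, v) \<in> T \<Longrightarrow> v \<in> N" "(u, v) \<in> T \<Longrightarrow> (v, u) \<in> T"
    by (fact *(1), fact *(2), fact *(3))
qed

lemma copy_simple: "simple_graph (copy A v)"
  using base_simple by (simp add: copy_def)

lemma copy_connected: "connected_graph (copy A v)"
  using base_connected by (simp add: copy_def)

lemma lab_idx: "(u, v) \<in> T \<Longrightarrow> lab A (u, v) \<in> idx A (cls A u)"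
proof -
  assume uv: "(u, v) \<in> T"
  then have "bij_betw (\<lambda>w. lab A (u, w)) (nbrs (ctree A) u) (idx A (cls A u))"
    using lab_bij T_D(1) by blast
  then show ?thesis using uv by (auto simp: nbrs_def bij_betw_def)
qed

lemma adhe_verts: "(u, v) \<in> T \<Longrightarrow> adhe u v \<subseteq> verts (copy A u)"
  using lab_idx[of u v] adh_verts by (simp add: adhe_def copy_def)

text \<open>The data state inversion only from the first side to the second. For the other
  direction, write \<open>x\<close> as a bonded image, using surjectivity.\<close>

lemma bonde:
  assumes uv: "(u, v) \<in> T" and x: "x \<in> adhe u v"
  shows "bonde u v x \<in> adhe v u" and "bonde v u (bonde u v x) = x"
proof -
  define k where "k = lab A (u, v)"
  define l where "l = lab A (v, u)"
  have kl: "k \<in> idx A (cls A u)" "l \<in> idx A (cls A v)"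
    using lab_idx uv T_D(3) by (auto simp: k_def l_def)
  have "bond A k l x \<in> adh A l \<and> bond A l k (bond A k l x) = x"
  proof (cases "cls A u")
    case First
    then have "cls A v = Second" using cls_T[OF uv] by (cases "cls A v") auto
    then show ?thesis
      using bond_bij[of k l] bond_inverse[of k l x] kl First x
      unfolding adhe_def k_def[symmetric] by (auto dest: bij_betwE)
  next
    case Second
    then have "cls A v = First" using cls_T[OF uv] by (cases "cls A v") auto
    then have b: "bij_betw (bond A l k) (adh A l) (adh A k)"
        "\<And>x. x \<in> adh A l \<Longrightarrow> bond A k l (bond A l k x) = x"
      using bond_bij[of l k] bond_inverse[of l k] kl Second by auto
    have "x \<in> adh A k" using x by (simp add: adhe_def k_def)
    then obtain y where "y \<in> adh A l" "x = bond A l k y" using b(1) by (auto simp: bij_betw_def)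
    then show ?thesis using b(2) by simp
  qed
  then show "bonde u v x \<in> adhe v u" "bonde v u (bonde u v x) = x"
    by (auto simp: bonde_def adhe_def k_def l_def)
qed

lemma conn_edges_eq: "conn_edges A = {((u, x), (v, bonde u v x)) | u v x. (u, v) \<in> T \<and> x \<in> adhe u v}"
  by (simp add: conn_edges_def bonde_def adhe_def)

lemma conn_sym: "sym (conn_edges A)"
  unfolding sym_def conn_edges_eq using bonde T_D(3) by fastforce

lemma proj_eq_iff: "proj A a = proj A b \<longleftrightarrow> (a, b) \<in> (conn_edges A)\<^sup>*"
proof
  assume "proj A a = proj A b"
  then show "(a, b) \<in> (conn_edges A)\<^sup>*" by (auto simp: proj_def)
next
  assume ab: "(a, b) \<in> (conn_edges A)\<^sup>*"
  then have "(b, a) \<in> (conn_edges A)\<^sup>*" using sym_rtrancl[OF conn_sym] symD by metis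
  with ab show "proj A a = proj A b" by (auto simp: proj_def)
qed

lemma proj_bonde: "\<lbrakk>(u, v) \<in> T; x \<in> adhe u v\<rbrakk> \<Longrightarrow> proj A (v, bonde u v x) = proj A (u, x)"
  by (rule sym, unfold proj_eq_iff, rule r_into_rtrancl) (auto simp: conn_edges_eq)

lemma verts_amalgam: "verts (amalgamation A) = \<Union> (P ` N)"
  by (auto simp: amalgamation_def graph_sum_def P_def image_iff)

text \<open>Connecting edges have their ends identified by the contraction, so every surviving edge
  comes from inside a copy.\<close>

lemma adj_amalgam:
  "adj (amalgamation A) = {(proj A (v, x), proj A (v, y)) | v x y.
    v \<in> N \<and> (x, y) \<in> adj (copy A v) \<and> proj A (v, x) \<noteq> proj A (v, y)}"
proof -
  have "proj A a = proj A b" if "(a, b) \<in> conn_edges A" for a b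
    using that by (simp add: proj_eq_iff r_into_rtrancl)
  then show ?thesis by (fastforce simp: amalgamation_def graph_sum_def)
qed

lemma adj_amalgam_part:
  assumes "(z, w) \<in> adj (amalgamation A)"
  shows "\<exists>v\<in>N. z \<in> P v \<and> w \<in> P v"
proof -
  obtain v x y where *: "z = proj A (v, x)" "w = proj A (v, y)" "v \<in> N" "(x, y) \<in> adj (copy A v)"
    using assms by (auto simp: adj_amalgam)
  then have "z \<in> P v" "w \<in> P v"
    unfolding P_def using simple_graphD(1,2)[OF copy_simple *(4)] by blast+
  then show ?thesis using *(3) by blast
qed

lemma amalgam_simple: "simple_graph (amalgamation A)"
  unfolding simple_graph_def
proof (intro conjI)
  show "adj (amalgamation A) \<subseteq> verts (amalgamation A) \<times> verts (amalgamation A)"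
    using adj_amalgam_part by (fastforce simp: verts_amalgam)
  show "sym (adj (amalgamation A))"
  proof (rule symI)
    fix z w assume "(z, w) \<in> adj (amalgamation A)"
    then obtain v x y where "z = proj A (v, x)" "w = proj A (v, y)" "v \<in> N"
        "(x, y) \<in> adj (copy A v)" "z \<noteq> w"
      by (auto simp: adj_amalgam)
    moreover from this(4) have "(y, x) \<in> adj (copy A v)" by (rule simple_graphD(3)[OF copy_simple])
    ultimately show "(w, z) \<in> adj (amalgamation A)" unfolding adj_amalgam by blast
  qed
  show "irrefl (adj (amalgamation A))"
    unfolding adj_amalgam irrefl_def by blast
qed

end

sublocale amalgam \<subseteq> am: conn_graph "amalgamation A"
  using amalgam_simple amalgam_connected by unfold_locales

section \<open>Normal forms for the contracted vertices\<close>

locale rooted_amalgam = amalgam A + rooted_tree "verts (ctree A)" r p dep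
  for A :: "('v, 'i, 't) amalg" and r p dep +
  assumes par_adj: "\<lbrakk>v \<in> verts (ctree A); v \<noteq> r\<rbrakk> \<Longrightarrow> (v, p v) \<in> adj (ctree A)"
    and adj_par: "(u, v) \<in> adj (ctree A) \<Longrightarrow> u \<noteq> r \<and> v = p u \<or> v \<noteq> r \<and> u = p v"
begin

text \<open>The highest copy of a vertex: climb to the parent as long as the vertex lies in the adhesion
  set. Since this is constant along connecting edges, it is a normal form for the contraction.\<close>

definition rep :: "'t \<Rightarrow> 'v \<Rightarrow> 't \<times> 'v"
  where "rep = (SOME g. g r = Pair r \<and> (\<forall>v\<in>N. v \<noteq> r \<longrightarrow>
    g v = (\<lambda>x. if x \<in> adhe v (p v) then g (p v) (bonde v (p v) x) else (v, x))))"

lemma rep_root: "rep r x = (r, x)"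
  and rep_step: "\<lbrakk>v \<in> N; v \<noteq> r\<rbrakk> \<Longrightarrow>
    rep v x = (if x \<in> adhe v (p v) then rep (p v) (bonde v (p v) x) else (v, x))"
proof -
  have ex: "\<exists>g. g r = Pair r \<and> (\<forall>v\<in>N. v \<noteq> r \<longrightarrow>
      g v = (\<lambda>x. if x \<in> adhe v (p v) then g (p v) (bonde v (p v) x) else (v, x)))"
    by (rule par_recursion[where \<Phi> = "\<lambda>v g x. if x \<in> adhe v (p v)
      then g (bonde v (p v) x) else (v, x)"])
  from someI_ex[OF ex] have "rep r = Pair r \<and> (\<forall>v\<in>N. v \<noteq> r \<longrightarrow>
      rep v = (\<lambda>x. if x \<in> adhe v (p v) then rep (p v) (bonde v (p v) x) else (v, x)))"
    unfolding rep_def .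
  then show "rep r x = (r, x)" "\<lbrakk>v \<in> N; v \<noteq> r\<rbrakk> \<Longrightarrow>
      rep v x = (if x \<in> adhe v (p v) then rep (p v) (bonde v (p v) x) else (v, x))"
    by auto
qed

lemma rep_conn_edge:
  assumes "((u, x), (v, y)) \<in> conn_edges A"
  shows "rep u x = rep v y"
proof -
  have uv: "(u, v) \<in> T" "x \<in> adhe u v" "y = bonde u v x" using assms by (auto simp: conn_edges_eq)
  from adj_par[OF uv(1)] show ?thesis
  proof
    assume "u \<noteq> r \<and> v = p u"
    then show ?thesis using rep_step[of u x] uv T_D(1) by auto
  next
    assume "v \<noteq> r \<and> u = p v"
    then show ?thesis using rep_step[of v y] bonde[OF uv(1,2)] uv(3) T_D(2)[OF uv(1)] by auto
  qed
qed

lemma rep_proj: "proj A a = proj A b \<Longrightarrow> case_prod rep a = case_prod rep b"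
  unfolding proj_eq_iff
proof (induction rule: rtrancl_induct)
  case (step b c)
  then show ?case using rep_conn_edge[of "fst b" "snd b" "fst c" "snd c"] by (simp add: case_prod_beta)
qed simp

lemma rep_anc: "v \<in> N \<Longrightarrow> fst (rep v x) \<preceq> v"
proof (induction arbitrary: x rule: node_induct)
  case (node v)
  then show ?case using anc_trans[OF _ anc_par] by (auto simp: rep_step)
qed (simp add: rep_root)

lemma rep_climbs:
  assumes "v \<in> N" "fst (rep v x) \<noteq> v"
  shows "v \<noteq> r" "x \<in> adhe v (p v)"
proof -
  show "v \<noteq> r" using assms rep_root by auto
  then show "x \<in> adhe v (p v)" using assms rep_step[of v x] by (auto split: if_splits)
qed

text \<open>Bonding maps are injective, so two climbing vertices are compared in the parent copy. A
  vertex that stays and one that climbs end at different nodes, as a climb never returns to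
  \<open>v\<close>. Consequently each copy embeds in the amalgamation.\<close>

lemma rep_inj: "\<lbrakk>v \<in> N; rep v x = rep v y\<rbrakk> \<Longrightarrow> x = y"
proof (induction arbitrary: x y rule: node_induct)
  case (node v)
  have climb: "fst (rep (p v) z) \<noteq> v" for z
    using rep_anc[OF par[OF node.hyps(1)], of z] not_anc_par[OF node.hyps] by auto
  have adj: "(v, p v) \<in> T" using par_adj node.hyps by blast
  show ?case
  proof (cases "x \<in> adhe v (p v) \<and> y \<in> adhe v (p v)")
    case True
    then have "bonde v (p v) x = bonde v (p v) y" using node by (simp add: rep_step)
    then show ?thesis using True bonde(2)[OF adj] by metis
  next
    case False
    have climbed: "w \<notin> adhe v (p v)" if "rep v w = (v, w')" for w w'
      using that climb[of "bonde v (p v) w"] rep_step[OF node.hyps, of w] by auto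
    have stay: "rep v w = (v, w)" if "w \<notin> adhe v (p v)" for w
      using that rep_step[OF node.hyps] by simp
    from False consider "x \<notin> adhe v (p v)" | "y \<notin> adhe v (p v)" by blast
    then show ?thesis
    proof cases
      case 1
      then have "rep v y = (v, x)" using stay node.prems by metis
      then show ?thesis using climbed stay by fastforce
    next
      case 2
      then have "rep v x = (v, y)" using stay node.prems by metis
      then show ?thesis using climbed stay by fastforce
    qed
  qed
qed (simp add: rep_root)

lemma proj_inj: "\<lbrakk>v \<in> N; proj A (v, x) = proj A (v, y)\<rbrakk> \<Longrightarrow> x = y"
  using rep_proj[of "(v, x)" "(v, y)"] rep_inj[of v x y] by simp

lemma rep_valid:
  assumes "v \<in> N" "x \<in> verts (copy A v)" "rep v x = (u, y)"
  shows "u \<in> N \<and> y \<in> verts (copy A u) \<and> proj A (u, y) = proj A (v, x)"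
  using assms
proof (induction arbitrary: x rule: node_induct)
  case root
  then show ?case using root_node by (simp add: rep_root)
next
  case (node v)
  have adj: "(v, p v) \<in> T" using par_adj node.hyps by blast
  show ?case
  proof (cases "x \<in> adhe v (p v)")
    case True
    have "bonde v (p v) x \<in> verts (copy A (p v))"
      using bonde(1)[OF adj True] adhe_verts T_D(3)[OF adj] by blast
    then show ?thesis
      using node True proj_bonde[OF adj True] by (simp add: rep_step)
  next
    case False
    then show ?thesis using node by (simp add: rep_step)
  qed
qed

text \<open>The choice of a member of the class is immaterial, because \<open>rep\<close> is
  constant on classes.\<close>

definition t :: "('t \<times> 'v) set \<Rightarrow> 't"
  where "t z = fst (case_prod rep (SOME a. proj A a = z))"

lemma t_proj: "t (proj A (v, x)) = fst (rep v x)"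
proof -
  have "proj A (SOME a. proj A a = proj A (v, x)) = proj A (v, x)" by (rule someI) simp
  from rep_proj[OF this] show ?thesis by (simp add: t_def)
qed

lemma up_part:
  assumes "v \<in> N" "proj A (v, x) = z" "v \<noteq> t z"
  shows "v \<noteq> r" "x \<in> adhe v (p v)" "bonde v (p v) x \<in> verts (copy A (p v))"
    "proj A (p v, bonde v (p v) x) = z"
proof -
  have "fst (rep v x) \<noteq> v" using assms t_proj by auto
  then show *: "v \<noteq> r" "x \<in> adhe v (p v)" using rep_climbs assms(1) by blast+
  have adj: "(v, p v) \<in> T" using par_adj assms(1) *(1) by blast
  show "bonde v (p v) x \<in> verts (copy A (p v))"
    using bonde(1)[OF adj *(2)] adhe_verts T_D(3)[OF adj] by blast
  show "proj A (p v, bonde v (p v) x) = z" using proj_bonde[OF adj *(2)] assms(2) by simp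
qed

end

sublocale rooted_amalgam \<subseteq> dec: rooted_decomposition "amalgamation A" "verts (ctree A)" r p dep P t
proof
  fix v assume v: "v \<in> N"
  show "P v \<subseteq> verts (amalgamation A)" using v by (auto simp: verts_amalgam)
  show "P v \<noteq> {}" using copy_connected by (auto simp: P_def connected_graph_def)
next
  fix x y assume "(x, y) \<in> adj (amalgamation A)"
  then show "\<exists>v\<in>N. x \<in> P v \<and> y \<in> P v" by (rule adj_amalgam_part)
next
  fix z assume "z \<in> verts (amalgamation A)"
  then obtain v x where v: "v \<in> N" "x \<in> verts (copy A v)" "z = proj A (v, x)"
    by (auto simp: verts_amalgam P_def)
  have "t z = fst (rep v x)" using t_proj v(3) by simp
  then show "t z \<in> N" "z \<in> P (t z)"
    using rep_valid[OF v(1,2)] v(3) by (auto simp: P_def image_iff) (metis prod.collapse)+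
next
  fix v z assume v: "v \<in> N" "z \<in> P v" "v \<noteq> t z"
  then obtain x where "z = proj A (v, x)" by (auto simp: P_def)
  then show "v \<noteq> r \<and> z \<in> P (p v)"
    using up_part[OF v(1) _ v(3), of x] by (auto simp: P_def image_iff) 
qed

section \<open>Adhesion sets and distances in the amalgamation\<close>

context rooted_amalgam
begin

abbreviation X where "X \<equiv> amalgamation A"

text \<open>A vertex of \<open>dec.sep v\<close> does not have its top node at \<open>v\<close>, so
  its preimage in the copy at \<open>v\<close> climbs and must lie in the adhesion set. By
  injectivity on the parent copy, its preimage there is the bonded image.\<close>

lemma sep_adhe:
  assumes v: "v \<in> N" "v \<noteq> r" and z: "z \<in> dec.sep v"
  shows "proj A (v, x) = z \<Longrightarrow> x \<in> adhe v (p v)" and "proj A (p v, y) = z \<Longrightarrow> y \<in> adhe (p v) v"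
proof -
  have adj: "(v, p v) \<in> T" using par_adj v by blast
  have ne: "v \<noteq> t z" using dec.sep_not_below[OF v z] by auto
  show "x \<in> adhe v (p v)" if "proj A (v, x) = z" for x using up_part(2)[OF v(1) that ne] .
  show "y \<in> adhe (p v) v" if y: "proj A (p v, y) = z"
  proof -
    obtain x where x: "proj A (v, x) = z" using z by (auto simp: dec.sep_def P_def)
    have "y = bonde v (p v) x"
      using proj_inj[OF par[OF v(1)]] up_part(4)[OF v(1) x ne] y by simp
    then show ?thesis using bonde(1)[OF adj] up_part(2)[OF v(1) x ne] by simp
  qed
qed

lemma dist_proj_le:
  assumes v: "v \<in> N" and xy: "x \<in> verts (copy A v)" "y \<in> verts (copy A v)"
  shows "graph_dist X (proj A (v, x)) (proj A (v, y)) \<le> graph_dist (copy A v) x y"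
proof -
  interpret c: conn_graph "copy A v" using copy_simple copy_connected by unfold_locales
  have edge: "(proj A (v, a), proj A (v, b)) \<in> adj X" if "(a, b) \<in> adj (copy A v)" for a b
  proof -
    have "a \<noteq> b" using that simple_graphD(4)[OF copy_simple] by auto
    then have "proj A (v, a) \<noteq> proj A (v, b)" using proj_inj[OF v] by blast
    then show ?thesis using that v by (auto simp: adj_amalgam)
  qed
  have "(proj A (v, x), proj A (v, y)) \<in> adj X ^^ graph_dist (copy A v) x y"
    using c.dist_walk[OF xy] by (rule relpow_map[where h = "\<lambda>x. proj A (v, x)"]) (rule edge)
  then show ?thesis by (rule graph_dist_le)
qed

lemma child_of_root: "\<lbrakk>v \<in> N; v \<noteq> r\<rbrakk> \<Longrightarrow> \<exists>c\<in>N. c \<noteq> r \<and> p c = r \<and> c \<preceq> v"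
proof (induction rule: node_induct)
  case (node v)
  then show ?case using anc_trans[OF _ anc_par] by (cases "p v = r") (blast intro: anc_refl)+
qed simp

lemma children_of_root_eq:
  assumes "v \<in> N" "c \<preceq> v" "c' \<preceq> v" "c \<noteq> r" "c' \<noteq> r" "p c = r" "p c' = r"
  shows "c = c'"
  using anc_linear[OF assms(2,3)] anc_cases[of c c'] anc_cases[of c' c] anc_of_root assms by auto

text \<open>A walk that leaves the copy at the root returns to it through the adhesion set it left by,
  so the whole excursion costs at most \<open>K\<close>.\<close>

lemma root_copy_walk:
  assumes K: "1 \<le> K" "\<And>c x y. \<lbrakk>(r, c) \<in> T; x \<in> adhe r c; y \<in> adhe r c\<rbrakk> \<Longrightarrow>
      graph_dist (copy A r) x y \<le> K"
    and x: "x \<in> verts (copy A r)"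
    and walk: "(proj A (r, x), z) \<in> adj X ^^ k"
  shows "(\<forall>y\<in>verts (copy A r). z = proj A (r, y) \<longrightarrow> graph_dist (copy A r) x y \<le> K * k) \<and>
    (\<forall>c\<in>N. c \<noteq> r \<and> p c = r \<and> c \<preceq> t z \<longrightarrow>
      (\<forall>y\<in>adhe r c. graph_dist (copy A r) x y \<le> K * k))"
  using walk
proof (induction k arbitrary: z)
  case 0
  then have z: "z = proj A (r, x)" by simp
  then have tz: "t z = r" by (simp add: t_proj rep_root)
  show ?case
  proof (intro conjI ballI impI)
    fix y assume "z = proj A (r, y)"
    then have "x = y" using z proj_inj[OF root_node(1)] by simp
    then show "graph_dist (copy A r) x y \<le> K * 0" by simp
  next
    fix c y assume "c \<noteq> r \<and> p c = r \<and> c \<preceq> t z"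
    then show "graph_dist (copy A r) x y \<le> K * 0" using tz anc_of_root by auto
  qed
next
  case (Suc k)
  interpret c: conn_graph "copy A r" using copy_simple copy_connected by unfold_locales
  let ?d = "graph_dist (copy A r)"
  from Suc.prems obtain w where w: "(proj A (r, x), w) \<in> adj X ^^ k" "(w, z) \<in> adj X" by auto
  note IH = Suc.IH[OF w(1)]
  obtain u a b where u: "u \<in> N" "(a, b) \<in> adj (copy A u)" "w = proj A (u, a)" "z = proj A (u, b)"
    using w(2) by (auto simp: adj_amalgam)
  have ab: "a \<in> verts (copy A u)" "b \<in> verts (copy A u)" using u(2) simple_graphD[OF copy_simple] by blast+
  have wu: "w \<in> P u" and zu: "z \<in> P u" using u ab by (auto simp: P_def)
  have tw: "t w \<preceq> u" and tz: "t z \<preceq> u" using dec.top_anc u(1) wu zu by blast+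
  have wV: "w \<in> verts X" using dec.part_vert u(1) wu .
  have t_r: "t (proj A (r, y)) = r" for y by (simp add: t_proj rep_root)
  \<comment> \<open>A vertex of the root copy that also occurs below the child \<open>c\<close>
    belongs to the separator at \<open>c\<close>, hence to the adhesion set towards
    \<open>c\<close>.\<close>
  have in_adhe: "y \<in> adhe r c"
    if c: "c \<in> N" "c \<noteq> r" "p c = r" "c \<preceq> u" and y: "proj A (r, y) \<in> P u" for c y
  proof -
    have "\<not> c \<preceq> t (proj A (r, y))" using t_r c(2) anc_of_root by auto
    then have "proj A (r, y) \<in> dec.sep c" using dec.mem_sep[OF u(1) y c(4)] by blast
    then show ?thesis using sep_adhe(2)[OF c(1,2)] c(3) by simp
  qed
  have root_child: "(r, c) \<in> T" if "c \<in> N" "c \<noteq> r" "p c = r" for c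
    using par_adj[OF that(1,2)] T_D(3) that(3) by simp
  show ?case
  \<comment> \<open>If \<open>w\<close> lies in the root copy, the last edge either stays there or
    joins the adhesion set of one child, and costs at most \<open>K\<close>. If not,
    \<open>w\<close> and \<open>z\<close> lie in a part below one child \<open>c0\<close>, and the
    induction hypothesis already bounds the distance to all of its adhesion set.\<close>
  proof (cases "t w = r")
    case True
    then have "w \<in> P r" using dec.top(2)[OF wV] by simp
    then obtain y0 where y0: "y0 \<in> verts (copy A r)" "w = proj A (r, y0)" by (auto simp: P_def)
    have xy0: "?d x y0 \<le> K * k" using IH y0 by blast
    have extend: "?d x y \<le> K * Suc k" if "y \<in> verts (copy A r)" "?d y0 y \<le> K" for y
      using c.dist_triangle[OF x y0(1) that(1)] xy0 that(2) by simp
    have adhe_step: "?d x y \<le> K * Suc k"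
      if c: "c \<in> N" "c \<noteq> r" "p c = r" "c \<preceq> u" and y: "y \<in> adhe r c" for c y
      using extend[of y] K(2)[OF root_child[OF c(1-3)] in_adhe[OF c] y] y0(2) wu y
        adhe_verts[OF root_child[OF c(1-3)]] by auto
    show ?thesis
    proof (intro conjI ballI impI)
      fix y assume y: "y \<in> verts (copy A r)" "z = proj A (r, y)"
      show "?d x y \<le> K * Suc k"
      proof (cases "u = r")
        case True
        then have "a = y0" "b = y" using proj_inj[OF root_node(1)] u(3,4) y0(2) y(2) by auto
        then have "(y0, y) \<in> adj (copy A r) ^^ 1" using u(2) True by simp
        then have "?d y0 y \<le> 1" by (rule graph_dist_le)
        then show ?thesis using extend[OF y(1)] K(1) by simp
      next
        case False
        then obtain c where c: "c \<in> N" "c \<noteq> r" "p c = r" "c \<preceq> u" using child_of_root u(1) by blast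
        show ?thesis using adhe_step[OF c in_adhe[OF c]] zu y(2) by simp
      qed
    next
      fix c y assume "c \<in> N" "c \<noteq> r \<and> p c = r \<and> c \<preceq> t z" "y \<in> adhe r c"
      then show "?d x y \<le> K * Suc k" using adhe_step anc_trans[OF _ tz] by blast
    qed
  next
    case False
    then obtain c0 where c0: "c0 \<in> N" "c0 \<noteq> r" "p c0 = r" "c0 \<preceq> t w"
      using child_of_root dec.top(1)[OF wV] by blast
    have c0u: "c0 \<preceq> u" using anc_trans[OF c0(4) tw] .
    have step: "?d x y \<le> K * Suc k" if "y \<in> adhe r c0" for y
      using IH c0 that by (fastforce intro: le_trans)
    show ?thesis
    proof (intro conjI ballI impI)
      fix y assume "y \<in> verts (copy A r)" "z = proj A (r, y)"
      then show "?d x y \<le> K * Suc k" using step in_adhe[OF c0(1-3) c0u] zu by simp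
    next
      fix c y assume c: "c \<in> N" "c \<noteq> r \<and> p c = r \<and> c \<preceq> t z" "y \<in> adhe r c"
      then have "c = c0"
        using children_of_root_eq[OF u(1) _ c0u _ c0(2) _ c0(3)] anc_trans[OF _ tz] by blast
      then show "?d x y \<le> K * Suc k" using step c(3) by simp
    qed
  qed
qed

text \<open>The bound for an arbitrary copy follows by rerooting the tree at its node, since the
  amalgamation and its parts do not depend on the root.\<close>

lemma dist_root_copy_le:
  assumes K: "1 \<le> K" "\<And>c x y. \<lbrakk>(r, c) \<in> T; x \<in> adhe r c; y \<in> adhe r c\<rbrakk> \<Longrightarrow>
      graph_dist (copy A r) x y \<le> K"
    and xy: "x \<in> verts (copy A r)" "y \<in> verts (copy A r)"
  shows "graph_dist (copy A r) x y \<le> K * graph_dist X (proj A (r, x)) (proj A (r, y))"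
proof -
  have "proj A (r, x) \<in> verts X" "proj A (r, y) \<in> verts X"
    using xy root_node(1) by (auto simp: verts_amalgam P_def)
  note walk = am.dist_walk[OF this]
  have "\<forall>y'\<in>verts (copy A r). proj A (r, y) = proj A (r, y') \<longrightarrow>
      graph_dist (copy A r) x y' \<le> K * graph_dist X (proj A (r, x)) (proj A (r, y))"
    by (rule conjunct1, rule root_copy_walk[OF _ _ xy(1) walk]) (fact K)+
  then show ?thesis using xy(2) by blast
qed

text \<open>Climbing to \<open>t z\<close> connects all nodes whose parts contain \<open>z\<close>,
  so these nodes form the maximal identification subtree of \<open>z\<close>, which finite
  identification bounds.\<close>

lemma finite_nodes_of_vertex:
  assumes "finite_identification A" "z \<in> verts X"
  shows "finite {u \<in> N. z \<in> P u}"
proof -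
  define U where "U = {u \<in> N. z \<in> P u}"
  let ?I = "induced (ctree A) U"
  have tU: "t z \<in> U" using dec.top assms(2) by (simp add: U_def)
  have sym: "sym ((adj ?I)\<^sup>*)"
    by (rule sym_rtrancl) (use T_D(3) in \<open>auto simp: induced_def sym_def\<close>)
  have to_top: "(u, t z) \<in> (adj ?I)\<^sup>*" if "u \<in> N" "u \<in> U" for u
    using that
  proof (induction rule: node_induct)
    case root
    then show ?case using dec.top_anc[of r z] anc_of_root by (fastforce simp: U_def)
  next
    case (node v)
    show ?case
    proof (cases "v = t z")
      case False
      then have "p v \<in> U" using dec.up[of v z] node par by (auto simp: U_def)
      then show ?thesis
        using node par_adj by (auto simp: induced_def intro: converse_rtrancl_into_rtrancl)
    qed simp
  qed
  have "tree ?I"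
    unfolding tree_def
  proof (intro conjI)
    show "simple_graph ?I"
      using tree_T by (auto simp: tree_def simple_graph_def induced_def sym_def irrefl_def)
    show "connected_graph ?I"
      unfolding connected_graph_def
    proof (intro conjI ballI)
      show "verts ?I \<noteq> {}" using tU by (auto simp: induced_def U_def)
      fix u w assume "u \<in> verts ?I" "w \<in> verts ?I"
      then have "(u, t z) \<in> (adj ?I)\<^sup>*" "(t z, w) \<in> (adj ?I)\<^sup>*"
        using to_top symD[OF sym] by (auto simp: induced_def)
      then show "(u, w) \<in> (adj ?I)\<^sup>*" by (rule rtrancl_trans)
    qed
    show "\<nexists>q. cycle ?I q"
    proof
      assume "\<exists>q. cycle ?I q"
      then obtain q where "cycle ?I q" ..
      then have "cycle (ctree A) q" by (auto simp: cycle_def induced_def)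
      then show False using tree_T by (auto simp: tree_def)
    qed
  qed
  then have "max_ident_subtree A z U"
    unfolding max_ident_subtree_def ident_subtree_def by (auto simp: U_def P_def)
  then show ?thesis using assms unfolding finite_identification_def U_def by blast
qed

end

section \<open>Uniform bounds from the group actions\<close>

context amalgam
begin

lemma rooted_at: "r \<in> N \<Longrightarrow> \<exists>p dep. rooted_amalgam A r p dep"
proof -
  assume "r \<in> N"
  then obtain p dep where *: "rooted_tree N r p dep" "\<forall>v\<in>N. v \<noteq> r \<longrightarrow> (v, p v) \<in> T"
      "\<forall>u v. (u, v) \<in> T \<longrightarrow> u \<noteq> r \<and> v = p u \<or> v \<noteq> r \<and> u = p v"
    using bipartite_tree_rooted[OF tree_T, of r "cls A"] cls_T by blast
  interpret rooted_tree N r p dep by (rule *(1))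
  have "rooted_amalgam A r p dep"
    using *(2,3) by unfold_locales blast+
  then show ?thesis by blast
qed

text \<open>Each index \<open>k\<close> whose adhesion set contains \<open>x\<close> labels an edge
  from \<open>v\<close> to a node whose part also contains the image of \<open>x\<close>. Only
  finitely many such nodes exist.\<close>

lemma finite_adhesion_sets_at:
  assumes fin: "finite_identification A" and v: "v \<in> N" and x: "x \<in> verts (copy A v)"
  shows "finite {k \<in> idx A (cls A v). x \<in> adh A k}"
proof -
  obtain p dep where "rooted_amalgam A v p dep" using rooted_at v by blast
  then interpret rooted_amalgam A v p dep .
  let ?U = "{u \<in> N. proj A (v, x) \<in> P u}"
  have "proj A (v, x) \<in> verts (amalgamation A)" using v x by (auto simp: verts_amalgam P_def)
  then have "finite ?U" using finite_nodes_of_vertex fin by blast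
  moreover have "{k \<in> idx A (cls A v). x \<in> adh A k} \<subseteq> (\<lambda>w. lab A (v, w)) ` ?U"
  proof clarify
    fix k assume k: "k \<in> idx A (cls A v)" "x \<in> adh A k"
    have "bij_betw (\<lambda>w. lab A (v, w)) (nbrs (ctree A) v) (idx A (cls A v))"
      using lab_bij v by blast
    then obtain w where w: "(v, w) \<in> T" "k = lab A (v, w)"
      using k(1) by (auto simp: bij_betw_def nbrs_def)
    have xw: "x \<in> adhe v w" using k(2) w(2) by (simp add: adhe_def)
    have "bonde v w x \<in> verts (copy A w)"
      using bonde(1)[OF w(1) xw] adhe_verts[OF T_D(3)[OF w(1)]] by blast
    then have "proj A (v, x) \<in> P w"
      using proj_bonde[OF w(1) xw] by (auto simp: P_def image_iff)
    then show "k \<in> (\<lambda>w. lab A (v, w)) ` ?U" using w T_D(2) by blast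
  qed
  ultimately show ?thesis using finite_surj by blast
qed

lemma respects_element_image:
  "respects_element A \<Gamma> \<psi> i \<gamma> \<Longrightarrow> \<exists>\<sigma>. bij_betw \<sigma> (idx A i) (idx A i) \<and>
    (\<forall>k\<in>idx A i. \<psi> i \<gamma> ` adh A k \<subseteq> adh A (\<sigma> k))"
  unfolding respects_element_def
  by (elim exE conjE, intro exI conjI ballI, assumption)
    (drule bspec, assumption, elim bexE conjE, assumption)

text \<open>Up to the group action only finitely many adhesion sets occur: each one can be moved so
  that it meets a finite set of orbit representatives, and every vertex lies in finitely many.\<close>

lemma adhesion_sets_bounded:
  fixes \<Gamma> :: "side \<Rightarrow> ('v \<Rightarrow> 'v) monoid"
  assumes fin: "finite_identification A" "finite_adhesion A"
    and act: "acts_quasi_transitively (\<Gamma> i) (\<psi> i) (base A i)"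
    and resp: "respects_group A \<Gamma> \<psi> i"
    and v: "v \<in> N" "cls A v = i"
  shows "\<exists>D. \<forall>k\<in>idx A i. \<forall>x\<in>adh A k. \<forall>y\<in>adh A k. graph_dist (base A i) x y \<le> D"
proof -
  let ?V = "verts (base A i)" and ?d = "graph_dist (base A i)"
  have ga: "group_action (\<Gamma> i) ?V (\<psi> i)"
    using act by (simp add: acts_quasi_transitively_def acts_on_graph_def)
  interpret group_action "\<Gamma> i" ?V "\<psi> i" by (rule ga)
  interpret group "\<Gamma> i" using group_hom group_hom_def by blast
  have dist: "?d (\<psi> i g x) (\<psi> i g y) = ?d x y"
    if g: "g \<in> carrier (\<Gamma> i)" and xy: "x \<in> ?V" "y \<in> ?V" for g x y
  proof (rule graph_dist_iso[OF _ _ _ _ xy])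
    show "simple_graph (base A i)" "simple_graph (base A i)" by (rule base_simple)+
    show "bij_betw (\<psi> i g) ?V ?V" using bij_prop0[OF g] by (simp add: Bij_def)
    show "(x, y) \<in> adj (base A i) \<longleftrightarrow> (\<psi> i g x, \<psi> i g y) \<in> adj (base A i)"
      if "x \<in> ?V" "y \<in> ?V" for x y
      using act g that by (simp add: acts_quasi_transitively_def acts_on_graph_def)
  qed
  define X0 where "X0 = (\<lambda>orb. SOME x. x \<in> orb) ` orbits (\<Gamma> i) ?V (\<psi> i)"
  have "finite X0" using act by (simp add: X0_def acts_quasi_transitively_def)
  have reps: "\<exists>g\<in>carrier (\<Gamma> i). \<psi> i g x \<in> X0" if x: "x \<in> ?V" for x
  proof -
    have "\<psi> i \<one>\<^bsub>\<Gamma> i\<^esub> x \<in> orbit (\<Gamma> i) (\<psi> i) x" by (auto simp: orbit_def)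
    then have "(SOME y. y \<in> orbit (\<Gamma> i) (\<psi> i) x) \<in> orbit (\<Gamma> i) (\<psi> i) x" by (rule someI)
    moreover have "(SOME y. y \<in> orbit (\<Gamma> i) (\<psi> i) x) \<in> X0"
      using x by (auto simp: X0_def orbits_def)
    ultimately show ?thesis by (auto simp: orbit_def)
  qed
  define K0 where "K0 = (\<Union>x\<in>X0 \<inter> ?V. {k \<in> idx A i. x \<in> adh A k})"
  have "finite K0"
    using \<open>finite X0\<close> finite_adhesion_sets_at[OF fin(1) v(1)] v(2) by (auto simp: K0_def copy_def)
  define Q where "Q = (\<Union>k\<in>K0. (\<lambda>(x, y). ?d x y) ` (adh A k \<times> adh A k))"
  have "finite (adh A k)" if "k \<in> K0" for k
    using that fin(2) by (auto simp: K0_def finite_adhesion_def)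
  then have Q: "finite Q" using \<open>finite K0\<close> by (auto simp: Q_def)
  have "?d x y \<le> Max Q" if k: "k \<in> idx A i" and xy: "x \<in> adh A k" "y \<in> adh A k" for k x y
  proof -
    have V: "x \<in> ?V" "y \<in> ?V" using adh_verts k xy by blast+
    obtain g where g: "g \<in> carrier (\<Gamma> i)" "\<psi> i g x \<in> X0" using reps V(1) by blast
    have "respects_element A \<Gamma> \<psi> i g" using resp g(1) by (simp add: respects_group_def)
    from respects_element_image[OF this]
    obtain s where s: "bij_betw s (idx A i) (idx A i)"
        "\<forall>k\<in>idx A i. \<psi> i g ` adh A k \<subseteq> adh A (s k)"
      by (elim exE conjE) (rule that)
    have sk: "s k \<in> idx A i" using s(1) k by (auto simp: bij_betw_def)
    have "\<psi> i g ` adh A k \<subseteq> adh A (s k)" using s(2) k by (rule bspec)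
    then have im: "\<psi> i g x \<in> adh A (s k)" "\<psi> i g y \<in> adh A (s k)" using xy by blast+
    have "s k \<in> K0" using sk im(1) g(2) adh_verts[OF sk] by (auto simp: K0_def)
    then have "?d (\<psi> i g x) (\<psi> i g y) \<in> Q" using im by (auto simp: Q_def)
    then show ?thesis using Max_ge[OF Q] dist[OF g(1) V] by simp
  qed
  then show ?thesis by blast
qed

text \<open>Bounded adhesion sets make the copies uniformly bi-Lipschitz. Labellings of the two base
  graphs at scale \<open>K * R\<close> therefore serve all parts at scale \<open>R\<close> with a
  common bound on the fibres.\<close>

lemma amalgamation_asdim_le:
  assumes fin: "finite_adhesion A" "finite_identification A"
    and resp: "respects_quasi_transitive_actions A"
    and n: "1 \<le> n" and le: "\<And>i. graph_asdim (base A i) \<le> enat n"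
  shows "graph_asdim (amalgamation A) \<le> enat n"
proof -
  obtain \<Gamma> :: "side \<Rightarrow> ('v \<Rightarrow> 'v) monoid" and \<psi>
    where act: "\<And>i. acts_quasi_transitively (\<Gamma> i) (\<psi> i) (base A i)"
      and "respects_actions A \<Gamma> \<psi>"
    using resp by (auto simp: respects_quasi_transitive_actions_def)
  then have "respects_group A \<Gamma> \<psi> First" "respects_group A \<Gamma> \<psi> Second"
    by (auto simp: respects_actions_def type1_respecting_def type2_respecting_def)
  then have rg: "respects_group A \<Gamma> \<psi> i" for i by (cases i) auto
  \<comment> \<open>The bound is conditional on a node of class \<open>i\<close>, as a connecting
    tree with a single node has nodes of only one class.\<close>
  have "\<exists>D. \<forall>v\<in>N. cls A v = i \<longrightarrow>
      (\<forall>k\<in>idx A i. \<forall>x\<in>adh A k. \<forall>y\<in>adh A k. graph_dist (base A i) x y \<le> D)" for i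
    using adhesion_sets_bounded[OF fin(2,1) act[of i] rg[of i]] by blast
  then obtain D where D: "\<And>i v k x y. \<lbrakk>v \<in> N; cls A v = i; k \<in> idx A i; x \<in> adh A k; y \<in> adh A k\<rbrakk>
      \<Longrightarrow> graph_dist (base A i) x y \<le> D i"
    by metis
  define K where "K = Suc (D First + D Second)"
  have K: "graph_dist (copy A u) x y \<le> K" if "(u, v) \<in> T" "x \<in> adhe u v" "y \<in> adhe u v" for u v x y
  proof -
    have "graph_dist (copy A u) x y \<le> D (cls A u)"
      using D[OF T_D(1)[OF that(1)] refl lab_idx[OF that(1)]] that(2,3) by (simp add: adhe_def copy_def)
    also have "\<dots> \<le> K" by (cases "cls A u") (auto simp: K_def)
    finally show ?thesis .
  qed
  obtain r where r: "r \<in> N" using tree_T by (auto simp: tree_def connected_graph_def)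
  obtain p dep where "rooted_amalgam A r p dep" using rooted_at r by blast
  then interpret rooted_amalgam A r p dep .
  obtain b where b: "b \<in> P r" using dec.part(2)[OF r] by blast
  have sep_bound: "graph_dist X y z \<le> K"
    if v: "v \<in> N" "v \<noteq> r" and yz: "y \<in> dec.sep v" "z \<in> dec.sep v" for v y z
  proof -
    obtain y' z' where *: "y' \<in> verts (copy A v)" "y = proj A (v, y')"
        "z' \<in> verts (copy A v)" "z = proj A (v, z')"
      using yz by (auto simp: dec.sep_def P_def)
    have "graph_dist (copy A v) y' z' \<le> K"
      using K[OF par_adj[OF v]] sep_adhe(1)[OF v] yz * by blast
    then show ?thesis using dist_proj_le[OF v(1) *(1,3)] *(2,4) by simp
  qed
  interpret bounded_decomposition X N r p dep P t K b
    using sep_bound b by unfold_locales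
  show ?thesis
  proof (rule decomposition_asdim_le[OF n])
    fix R
    have "\<exists>B. \<exists>f :: 'v \<Rightarrow> 'v set. scale_labelling (verts (base A i)) (graph_dist (base A i)) n (K * R) B f"
      for i
    proof -
      interpret b: conn_graph "base A i"
        using base_simple base_connected by unfold_locales
      show ?thesis using b.asdim_le_imp_labelling[OF le] .
    qed
    then obtain B and f :: "side \<Rightarrow> 'v \<Rightarrow> 'v set" where
      f: "\<And>i. scale_labelling (verts (base A i)) (graph_dist (base A i)) n (K * R) (B i) (f i)"
      by metis
    have "\<exists>g :: ('t \<times> 'v) set \<Rightarrow> 'v set. scale_labelling (P v) (graph_dist X) n R (B First + B Second) g"
      if v: "v \<in> N" for v
    proof -
      let ?W = "verts (copy A v)" and ?q = "\<lambda>x. proj A (v, x)"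
      have fv: "scale_labelling ?W (graph_dist (copy A v)) n (K * R) (B (cls A v)) (f (cls A v))"
        using f by (simp add: copy_def)
      have low: "graph_dist (copy A v) x y \<le> K * graph_dist X (?q x) (?q y)"
        if "x \<in> ?W" "y \<in> ?W" for x y
      proof -
        obtain p' dep' where "rooted_amalgam A v p' dep'" using rooted_at v by blast
        then interpret v: rooted_amalgam A v p' dep' .
        show ?thesis by (rule v.dist_root_copy_le[OF _ _ that]) (use K in \<open>auto simp: K_def\<close>)
      qed
      define e where "e = inv_into ?W ?q"
      have "inj_on ?q ?W" using proj_inj[OF v] by (intro inj_onI)
      then have e: "e (?q x) = x" if "x \<in> ?W" for x
        using inv_into_f_f[of ?q ?W x] that by (simp add: e_def)
      have "scale_labelling (P v) (graph_dist X) n R (B First + B Second) (f (cls A v) \<circ> e)"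
        unfolding scale_labelling_def
      proof (intro conjI ballI allI impI)
        fix y z assume yz: "y \<in> P v" "z \<in> P v" "(f (cls A v) \<circ> e) y = (f (cls A v) \<circ> e) z"
        then obtain y' z' where *: "y' \<in> ?W" "y = ?q y'" "z' \<in> ?W" "z = ?q z'" by (auto simp: P_def)
        have "graph_dist (copy A v) y' z' \<le> B (cls A v)"
          using fv yz(3) * e by (simp add: scale_labelling_def)
        moreover have "B (cls A v) \<le> B First + B Second" by (cases "cls A v") auto
        ultimately show "graph_dist X y z \<le> B First + B Second"
          using dist_proj_le[OF v *(1,3)] *(2,4) by simp
      next
        fix C assume C: "C \<subseteq> P v" "\<forall>x\<in>C. \<forall>y\<in>C. graph_dist X x y \<le> R"
        have "e ` C \<subseteq> ?W" using C(1) e by (auto simp: P_def)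
        moreover have "\<forall>x\<in>e ` C. \<forall>y\<in>e ` C. graph_dist (copy A v) x y \<le> K * R"
        proof clarify
          fix y z assume yz: "y \<in> C" "z \<in> C"
          then have "y \<in> P v" "z \<in> P v" using C(1) by blast+
          then obtain y' z' where *: "y' \<in> ?W" "y = ?q y'" "z' \<in> ?W" "z = ?q z'"
            by (auto simp: P_def)
          have "K * graph_dist X y z \<le> K * R" using C(2) yz by (intro mult_le_mono2) blast
          then have "graph_dist (copy A v) y' z' \<le> K * R"
            using low[OF *(1,3)] *(2,4) by (metis order_trans)
          then show "graph_dist (copy A v) (e y) (e z) \<le> K * R" using * e by simp
        qed
        ultimately show "finite ((f (cls A v) \<circ> e) ` C)" "card ((f (cls A v) \<circ> e) ` C) \<le> Suc n"
          using fv unfolding scale_labelling_def image_comp[symmetric] by auto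
      qed
      then show ?thesis by blast
    qed
    then show "\<exists>B. \<forall>v\<in>N. \<exists>g :: ('t \<times> 'v) set \<Rightarrow> 'v set. scale_labelling (P v) (graph_dist X) n R B g"
      by blast
  qed
qed

end

section \<open>Factorisations\<close>

lemma iterated_amalgamation_lfqtc: "iterated_amalgamation ti tt H \<K> \<Longrightarrow> lfqtc_graph H"
  by (induction rule: iterated_amalgamation.induct) auto

text \<open>Induction over the amalgamation steps. The factors of each step are connected as
  intermediate graphs, and the amalgamation inherits connectedness from the isomorphic graph
  \<open>H\<close>.\<close>

lemma iterated_amalgamation_asdim_le:
  assumes "iterated_amalgamation ti tt H \<K>" and n: "1 \<le> n"
    and "\<And>K. K \<in># \<K> \<Longrightarrow> simple_graph K \<and> graph_asdim K \<le> enat n"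
  shows "graph_asdim H \<le> enat n"
  using assms(1,3)
proof (induction rule: iterated_amalgamation.induct)
  case (single H K)
  then show ?case using graph_iso_asdim_le[of H K n] by (auto simp: lfqtc_graph_def)
next
  case (amalgamate A \<K> \<L> H)
  have H: "simple_graph H" "connected_graph H" using amalgamate.hyps by (auto simp: lfqtc_graph_def)
  have base: "connected_graph (base A i)" for i
    using iterated_amalgamation_lfqtc amalgamate.hyps(1,2) by (cases i) (auto simp: lfqtc_graph_def)
  have "graph_asdim (base A i) \<le> enat n" for i
    using amalgamate.IH amalgamate.prems by (cases i) auto
  note le = this
  have "amalgam A"
  proof
    show "amalg_data A" by fact
    show "connected_graph (amalgamation A)"
      using graph_iso_imp_connected[of H] amalgamate.hyps H by blast
  qed (rule base)
  then interpret amalgam A .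
  have "graph_asdim (amalgamation A) \<le> enat n"
    using amalgamation_asdim_le[OF _ _ _ n le] amalgamate.hyps by blast
  then show ?case
    using graph_iso_asdim_le[of H "amalgamation A"] amalgamate.hyps H amalgam_simple by blast
qed

theorem theorem1p2:
  fixes G :: "'v ugraph" and Gs :: "'v ugraph list"
  assumes "simple_graph G" and "locally_finite G" and "quasi_transitive G"
    and "connected_graph G" and "more_than_one_end G"
    and "factorisation TYPE('i) TYPE('t) G Gs"
  shows "graph_asdim G \<le> Max ({1} \<union> {graph_asdim H | H. H \<in> set Gs})"
proof -
  define M where "M = {1} \<union> {graph_asdim H | H. H \<in> set Gs}"
  have "M = {1} \<union> graph_asdim ` set Gs" by (auto simp: M_def)
  then have fin: "finite M" by simp
  show ?thesis
    unfolding M_def[symmetric]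
  proof (cases "Max M")
    case (enat n)
    \<comment> \<open>The element 1 of the maximum supplies the hypothesis \<open>1 \<le> n\<close>
      of the labelling argument; an infinite maximum leaves nothing to show.\<close>
    have "1 \<in> M" by (simp add: M_def)
    then have "1 \<le> enat n" using Max_ge[OF fin] enat by metis
    then have n: "1 \<le> n" by (simp add: one_enat_def)
    have "simple_graph H \<and> graph_asdim H \<le> enat n" if "H \<in># mset Gs" for H
    proof -
      have H: "H \<in> set Gs" using that by simp
      then have "graph_asdim H \<in> M" by (auto simp: M_def)
      then show ?thesis
        using Max_ge[OF fin] enat H assms(6) by (auto simp: factorisation_def lfqtc_graph_def)
    qed
    then show "graph_asdim G \<le> Max M"
      using iterated_amalgamation_asdim_le[OF _ n] assms(6) enat
      unfolding factorisation_def by metis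
  qed simp
qed

end
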